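(* Let $K\in\mathbb{R}^{n\times n}$ be symmetric positive semidefinite, let $\mu>0$, $\delta\in(0,1)$, $\varepsilon\in(0,1)$, and let $\lambda>0$, $\sigma_k>0$. Let $\ell=\mathrm{rank}_\mu(K)$ and let $r$ be an integer with $r\le n$ and \[ r \geq \min\left\{n,\ \ell\left(1+\log\frac{\mathrm{tr}(K)}{\mathrm{tr}(K-\lfloor K\rfloor_{\ell})}\right)\right\}. \] Let $F=\mathrm{RPCholesky}(K,r)$ and $\widehat K=FF^{\top}$. Let $L\in\mathbb{R}^{n\times n}$ be symmetric with $L\succeq \mu I_n$, and set \[ P=\widehat K+\lambda\sigma_k\mathbf{1}_n\mathbf{1}_n^{\top}+L,\qquad A=K+\lambda\sigma_k\mathbf{1}_n\mathbf{1}_n^{\top}+L. \] Then, with probability at least $1-\delta$ (over the randomness of RPCholesky), $\kappa(P^{-1/2}AP^{-1/2})\le 3/\delta$, and furthermore, when the preconditioned conjugate gradient (PCG) method with preconditioner $P$ is applied to the linear system $Ad=b$ (for any $b\in\mathbb{R}^n$), its iterates $d^{\,t}$ satisfy \[ \|d^{\,t}-d^*\|_A\le \varepsilon\|d^*\|_A\quad\text{for every iteration } t\ge \delta^{-1/2}\log(2/\varepsilon), \] where $d^*=A^{-1}b$ is the exact solution.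
   Context: $\mathbf{1}_n$ is the all-ones vector in $\mathbb{R}^n$, $I_n$ the identity, $\succeq$ the Loewner order, $\mathrm{tr}$ the trace, $\kappa(\cdot)$ the condition number of a positive definite matrix, and $\|x\|_A=\sqrt{x^{\top}Ax}$. $\lambda_i(\cdot)$ is the $i$-th largest eigenvalue of a symmetric matrix. $\lfloor K\rfloor_\ell$ denotes the best rank-$\ell$ approximation of $K$ (from its $\ell$-truncated eigendecomposition). The $\mu$-tail rank is $\mathrm{rank}_\mu(K)=\min\{t\in\mathbb{N}:\sum_{i=t+1}^n\lambda_i(K)\le\mu\}$. $\mathrm{RPCholesky}(K,r)$ (randomly pivoted Cholesky) is the randomized algorithm: set $R^{(0)}=K$ and $F$ empty; for $i=1,\dots,r$, sample a pivot index $s_i\in[n]$ with probability $R^{(i-1)}_{jj}/\mathrm{tr}(R^{(i-1)})$ for index $j$, set $g=R^{(i-1)}_{:,s_i}/\sqrt{R^{(i-1)}_{s_is_i}}$, append $g$ as a new column of $F$, and set $R^{(i)}=R^{(i-1)}-gg^{\top}$; output $F\in\mathbb{R}^{n\times r}$. PCG is the standard preconditioned conjugate gradient method, started from the zero vector $d^0=0$. *)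

theory Defs
  imports "Jordan_Normal_Form.Char_Poly" "HOL-Probability.Probability_Mass_Function"
begin

definition mtrace :: "real mat \<Rightarrow> real" where
  "mtrace A = (\<Sum>i<dim_row A. A $$ (i, i))"

definition sym_psd :: "nat \<Rightarrow> real mat \<Rightarrow> bool" where
  "sym_psd n A \<longleftrightarrow> A \<in> carrier_mat n n \<and> transpose_mat A = A \<and>
     (\<forall>x \<in> carrier_vec n. 0 \<le> scalar_prod x (A *\<^sub>v x))"

definition loewner_ge :: "nat \<Rightarrow> real mat \<Rightarrow> real mat \<Rightarrow> bool" where
  "loewner_ge n A B \<longleftrightarrow> A \<in> carrier_mat n n \<and> B \<in> carrier_mat n n \<and> sym_psd n (A - B)"

(* eigenvalues (with algebraic multiplicity) in decreasing order:
   eigs A ! (i-1) is lambda_i(A) *)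
definition eigs :: "real mat \<Rightarrow> real list" where
  "eigs A = rev (sorted_list_of_multiset (proots (char_poly A)))"

definition eig_tail :: "real mat \<Rightarrow> nat \<Rightarrow> real" where
  "eig_tail A t = (\<Sum>i\<in>{t..<dim_row A}. eigs A ! i)"

definition tail_rank :: "real \<Rightarrow> real mat \<Rightarrow> nat" where
  "tail_rank \<mu> A = (LEAST t. eig_tail A t \<le> \<mu>)"

definition best_rank_approx :: "real mat \<Rightarrow> nat \<Rightarrow> real mat" where
  "best_rank_approx A l = (SOME B. \<exists>vs :: real Matrix.vec list.
      length vs = dim_row A \<and>
      (\<forall>i < dim_row A. vs ! i \<in> carrier_vec (dim_row A) \<and> A *\<^sub>v (vs ! i) = eigs A ! i \<cdot>\<^sub>v (vs ! i)) \<and>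
      (\<forall>i < dim_row A. \<forall>j < dim_row A. scalar_prod (vs ! i) (vs ! j) = (if i = j then 1 else 0)) \<and>
      B = Matrix.mat (dim_row A) (dim_row A) (\<lambda>(p, q). \<Sum>i<l. eigs A ! i * vec_index (vs ! i) p * vec_index (vs ! i) q))"

definition cond_num :: "real mat \<Rightarrow> real" where
  "cond_num A = hd (eigs A) / last (eigs A)"

definition mat_sqrt :: "real mat \<Rightarrow> real mat" where
  "mat_sqrt A = (THE S. sym_psd (dim_row A) S \<and> S * S = A)"

definition mat_inv :: "real mat \<Rightarrow> real mat" where
  "mat_inv A = (SOME B. B \<in> carrier_mat (dim_row A) (dim_row A) \<and> B * A = 1\<^sub>m (dim_row A))"

definition ones_mat :: "nat \<Rightarrow> real mat" where
  "ones_mat n = Matrix.mat n n (\<lambda>_. 1)"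

(* F F^T where F is given by its list of columns *)
definition gram_cols :: "nat \<Rightarrow> real Matrix.vec list \<Rightarrow> real mat" where
  "gram_cols n F = Matrix.mat n n (\<lambda>(p, q). \<Sum>g\<leftarrow>F. vec_index g p * vec_index g q)"

definition outer :: "nat \<Rightarrow> real Matrix.vec \<Rightarrow> real mat" where
  "outer n g = Matrix.mat n n (\<lambda>(p, q). vec_index g p * vec_index g q)"

(* RPCholesky: distribution of the output F (as list of its columns, in pivot order).
   Convention if the residual has zero trace (then it is 0): append zero columns. *)
fun rpc :: "nat \<Rightarrow> real mat \<Rightarrow> nat \<Rightarrow> real Matrix.vec list pmf" where
  "rpc n R 0 = return_pmf []"
| "rpc n R (Suc i) =
     (if mtrace R \<le> 0 then return_pmf (replicate (Suc i) (0\<^sub>v n))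
      else bind_pmf (embed_pmf (\<lambda>j. if j < n then R $$ (j, j) / mtrace R else 0))
        (\<lambda>s. let g = (1 / sqrt (R $$ (s, s))) \<cdot>\<^sub>v col R s
             in map_pmf (\<lambda>F. g # F) (rpc n (R - outer n g) i)))"

definition RPCholesky :: "real mat \<Rightarrow> nat \<Rightarrow> real Matrix.vec list pmf" where
  "RPCholesky K r = rpc (dim_row K) K r"

fun pcg_state :: "real mat \<Rightarrow> real mat \<Rightarrow> real Matrix.vec \<Rightarrow> nat \<Rightarrow> real Matrix.vec \<times> real Matrix.vec \<times> real Matrix.vec \<times> real Matrix.vec" where
  "pcg_state A P b 0 = (0\<^sub>v (dim_vec b), b, mat_inv P *\<^sub>v b, mat_inv P *\<^sub>v b)"
| "pcg_state A P b (Suc k) =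
     (let (d, r, z, p) = pcg_state A P b k;
          \<alpha> = scalar_prod r z / scalar_prod p (A *\<^sub>v p);
          d' = d + \<alpha> \<cdot>\<^sub>v p;
          r' = r - \<alpha> \<cdot>\<^sub>v (A *\<^sub>v p);
          z' = mat_inv P *\<^sub>v r';
          \<beta> = scalar_prod r' z' / scalar_prod r z;
          p' = z' + \<beta> \<cdot>\<^sub>v p
      in (d', r', z', p'))"

definition pcg :: "real mat \<Rightarrow> real mat \<Rightarrow> real Matrix.vec \<Rightarrow> nat \<Rightarrow> real Matrix.vec" where
  "pcg A P b t = fst (pcg_state A P b t)"

definition A_norm :: "real mat \<Rightarrow> real Matrix.vec \<Rightarrow> real" where
  "A_norm A x = sqrt (scalar_prod x (A *\<^sub>v x))"

end

theory Submission
  imports Defs "Jordan_Normal_Form.Schur_Decomposition"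
begin

unbundle no inner_syntax and no vec_syntax

hide_type (open) Finite_Cartesian_Product.vec
hide_const (open) Finite_Cartesian_Product.mat Finite_Cartesian_Product.vec

text \<open>Let \<open>R\<close> be the residual \<open>K - F F\<^sup>T\<close>. Split its trace along the eigenvectors of \<open>K\<close> into the
  mass \<open>a\<close> on the top \<open>l\<close> eigenvectors and the mass on the others, which is at most the initial
  value \<open>b\<close> because \<open>R\<close> only decreases. One step replaces \<open>R\<close> on average by \<open>R - R\<^sup>2 / tr R\<close>, so
  by Cauchy--Schwarz the expectation of \<open>a\<close> drops to at most \<open>a - a\<^sup>2 / (l (a + b))\<close>. This map is
  concave and increasing, hence it can be iterated through Jensen's inequality, and the potential
  \<open>ln x - b / x\<close> shows that \<open>l (1 + ln ((a + b) / b))\<close> steps bring \<open>a\<close> below \<open>b\<close>. Thus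
  \<open>E (tr R) \<le> 2 \<mu>\<close>, and by Markov's inequality \<open>tr R \<le> 2 \<mu> / \<delta>\<close> with probability at least
  \<open>1 - \<delta>\<close>. As \<open>A = P + R\<close> and \<open>P\<close> dominates \<open>\<mu> I\<close>, the eigenvalues of the preconditioned matrix
  then lie between \<open>1\<close> and \<open>1 + 2 / \<delta>\<close>, and the rate of PCG follows from its optimality in the
  Krylov space and the Chebyshev polynomial of this interval.\<close>

section \<open>Spectral theorem for real symmetric matrices\<close>

text \<open>Freezing the tail mass at \<open>b\<close> reduces the matrix recursion for the mean
  residual to a recursion for one real number, so scalar Jensen is enough. The parameter
  \<open>b\<close> has to be the true tail trace and not \<open>\<mu>\<close>: only then is (a + b)
  / b the ratio inside the logarithm of the hypothesis on \<open>r\<close>, while 2 b \<le> 2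
  \<open>\<mu>\<close> still holds. Two situations lie outside the recursion: r \<ge> n, where
  elimination is exact (this also covers a vanishing tail), and l = 0, where already tr K \<le>
  \<open>\<mu>\<close>. The constants: 1 + 2 / \<delta> \<le> 3 / \<delta> because \<delta> < 1. For
  the rate put s = sqrt (1 + 2 / \<delta>); then s \<le> 2 / sqrt \<delta> and ln ((s + 1) / (s -
  1)) \<ge> 2 / s, and the two factors 2 cancel, which leaves the factor \<delta> powr (-1/2) in
  front of ln (2 / \<epsilon>). A separate obstacle is that \<open>eigs\<close>,
  \<open>mat_sqrt\<close> and \<open>mat_inv\<close> are given by sorted roots of the characteristic
  polynomial, a definite description and a choice. Each has to be identified with the expected
  object first, which rests on a spectral theorem whose diagonal follows the order of
  \<open>eigs\<close>.\<close>

lemma sprod_assoc_sym: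
  fixes A :: "real mat"
  assumes "A \<in> carrier_mat n n" "transpose_mat A = A" "x \<in> carrier_vec n" "y \<in> carrier_vec n"
  shows "(A *\<^sub>v x) \<bullet> y = x \<bullet> (A *\<^sub>v y)"
  using transpose_vec_mult_scalar[of A n n y x] assms by simp

lemma sprod_self_nonneg: "0 \<le> v \<bullet> (v :: real vec)"
  by (simp add: scalar_prod_def sum_nonneg)

lemma sprod_self_pos: "v \<in> carrier_vec n \<Longrightarrow> v \<noteq> 0\<^sub>v n \<Longrightarrow> 0 < v \<bullet> (v :: real vec)"
  using conjugate_square_greater_0_vec[of v n] by simp

text \<open>The Rayleigh quotient of a complex eigenvector is evaluated in two ways:
  \<open>A\<close> is symmetric, and its real entries commute with conjugation, so \<open>a\<close>
  equals its conjugate.\<close>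

lemma hermitian_eigenvalue_real:
  fixes A :: "real mat"
  assumes A: "A \<in> carrier_mat n n" and sym: "transpose_mat A = A"
    and ev: "eigenvalue (map_mat complex_of_real A) a"
  shows "a \<in> \<real>"
proof -
  let ?C = "map_mat complex_of_real A"
  have C: "?C \<in> carrier_mat n n" using A by simp
  have Cs: "transpose_mat ?C = ?C" using sym by (metis map_mat_transpose)
  obtain x where x: "x \<in> carrier_vec n" "x \<noteq> 0\<^sub>v n" "?C *\<^sub>v x = a \<cdot>\<^sub>v x"
    using ev A unfolding eigenvalue_def eigenvector_def by auto
  let ?y = "conjugate x"
  have y: "?y \<in> carrier_vec n" using x by simp
  have Cy: "?C *\<^sub>v ?y = conjugate (?C *\<^sub>v x)"
    by (rule eq_vecI) (use x(1) A in \<open>auto simp: scalar_prod_def\<close>)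
  have "?y \<bullet> (?C *\<^sub>v x) = (?C *\<^sub>v ?y) \<bullet> x"
    using transpose_vec_mult_scalar[OF C x(1) y] Cs by simp
  also have "\<dots> = conjugate (a \<cdot>\<^sub>v x) \<bullet> x" using Cy x by simp
  also have "\<dots> = cnj a * (?y \<bullet> x)" using x by (simp add: conjugate_smult_vec)
  finally have "a * (?y \<bullet> x) = cnj a * (?y \<bullet> x)" using x by simp
  moreover have "?y \<bullet> x \<noteq> 0"
    using conjugate_square_eq_0_vec[OF x(1)] x comm_scalar_prod[OF y x(1)] by auto
  ultimately have "cnj a = a" by simp
  then show ?thesis by (simp add: Reals_cnj_iff)
qed

text \<open>Over the complex numbers the polynomial splits and all roots are real; the coefficient
  embedding is injective, so the factorization descends to the reals.\<close>

lemma real_symmetric_char_poly_splits: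
  fixes A :: "real mat"
  assumes A: "A \<in> carrier_mat n n" and sym: "transpose_mat A = A"
  shows "\<exists>as. char_poly A = (\<Prod>a\<leftarrow>as. [:- a, 1:])"
proof -
  let ?C = "map_mat complex_of_real A"
  have C: "?C \<in> carrier_mat n n" using A by simp
  obtain as where as: "char_poly ?C = (\<Prod>a\<leftarrow>as. [:- a, 1:])"
    using char_poly_factorized[OF C] by auto
  have "a \<in> \<real>" if "a \<in> set as" for a
  proof -
    have "poly (char_poly ?C) a = 0" using that unfolding as by (rule linear_poly_root)
    then show ?thesis using hermitian_eigenvalue_real[OF A sym] eigenvalue_root_char_poly[OF C] by simp
  qed
  then have re: "map (\<lambda>a. complex_of_real (Re a)) as = as" by (simp add: map_idI)
  interpret h: map_poly_inj_idom_hom complex_of_real ..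
  have prod: "(\<Prod>a\<leftarrow>map (\<lambda>a. complex_of_real (Re a)) bs. [:- a, 1:])
      = map_poly complex_of_real (\<Prod>a\<leftarrow>map Re bs. [:- a, 1:])" for bs
    by (induction bs) (simp_all add: of_real_hom.map_poly_pCons_hom h.hom_mult del: mult_pCons_left)
  have "map_poly complex_of_real (char_poly A) = map_poly complex_of_real (\<Prod>a\<leftarrow>map Re as. [:- a, 1:])"
    using as prod[of as] re of_real_hom.char_poly_hom[OF A, where ?'a = complex] by simp
  then have "char_poly A = (\<Prod>a\<leftarrow>map Re as. [:- a, 1:])"
    by (simp only: h.eq_iff)
  then show ?thesis by blast
qed

text \<open>The change of basis for deflation. Gram-Schmidt keeps the first vector of a basis that
  starts with \<open>v\<close>, so only a normalization remains.\<close>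

lemma orthogonal_mat_first_col:
  fixes v :: "real vec"
  assumes v: "v \<in> carrier_vec n" and v0: "v \<noteq> 0\<^sub>v n"
  shows "\<exists>W\<in>carrier_mat n n. transpose_mat W * W = 1\<^sub>m n \<and> col W 0 = (1 / sqrt (v \<bullet> v)) \<cdot>\<^sub>v v"
proof -
  interpret cof_vec_space n "TYPE(real)" .
  have n: "n > 0" using v v0 by (cases n) auto
  let ?b = "basis_completion v"
  note b = basis_completion[OF v v0]
  define ws where "ws = gram_schmidt n ?b"
  have ws: "set ws \<subseteq> carrier_vec n" "corthogonal ws" "length ws = n"
    using gram_schmidt_result[OF b(2,4,5) ws_def] b(6) by auto
  obtain vs where "?b = v # vs" using b(6,7) n by (cases ?b) auto
  then have hd: "ws ! 0 = v"
    using gram_schmidt_hd[OF v, of vs] ws(3) n unfolding ws_def by (cases "gram_schmidt n ?b") auto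
  have wi: "ws ! i \<in> carrier_vec n" if "i < n" for i using ws(1,3) that by auto
  define us where "us = map (\<lambda>w. (1 / sqrt (w \<bullet> w)) \<cdot>\<^sub>v w) ws"
  have us: "length us = n" "\<And>i. i < n \<Longrightarrow> us ! i = (1 / sqrt (ws ! i \<bullet> ws ! i)) \<cdot>\<^sub>v (ws ! i)"
    using ws(3) by (auto simp: us_def)
  have orth: "(ws ! i \<bullet> ws ! j = 0) = (i \<noteq> j)" if "i < n" "j < n" for i j
    using corthogonalD[OF ws(2)] that ws(3) by simp
  have pos: "ws ! i \<bullet> ws ! i > 0" if "i < n" for i
    using orth[OF that that] sprod_self_nonneg[of "ws ! i"] by (simp add: less_eq_real_def)
  have ui: "us ! i \<in> carrier_vec n" if "i < n" for i using us(2)[OF that] wi[OF that] by simp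
  have uu: "us ! i \<bullet> us ! j = (if i = j then 1 else 0)" if "i < n" "j < n" for i j
    using us(2)[OF that(1)] us(2)[OF that(2)] wi[OF that(1)] wi[OF that(2)] orth[OF that] pos[OF that(1)]
    by (auto simp: real_sqrt_mult[symmetric])
  define W where "W = mat_of_cols n us"
  have W: "W \<in> carrier_mat n n" using us by (simp add: W_def carrier_matI)
  have cW: "col W i = us ! i" if "i < n" for i using that us ui by (simp add: W_def)
  have "transpose_mat W * W = 1\<^sub>m n"
    by (rule eq_matI) (use W cW uu in auto)
  moreover have "col W 0 = (1 / sqrt (v \<bullet> v)) \<cdot>\<^sub>v v" using cW us(2) hd n by simp
  ultimately show ?thesis using W by blast
qed

lemma congruence_mult:
  fixes W X A :: "real mat"
  assumes W: "W \<in> carrier_mat n n" and X: "X \<in> carrier_mat n n" and A: "A \<in> carrier_mat n n"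
  shows "transpose_mat (W * X) * A * (W * X) = transpose_mat X * (transpose_mat W * A * W) * X"
proof -
  have "transpose_mat W \<in> carrier_mat n n" "transpose_mat X \<in> carrier_mat n n" using W X by auto
  then show ?thesis using W X A
    by (simp add: transpose_mult[OF W X] assoc_mult_mat[of _ n n _ n _ n])
qed

text \<open>Deflation, by induction on the list of roots. The list may come in any order, so the
  sorted list \<open>eigs A\<close> can be inserted directly and the diagonal carries its
  indices.\<close>

lemma orthogonal_diagonalization:
  fixes A :: "real mat"
  assumes "A \<in> carrier_mat n n" "transpose_mat A = A" "char_poly A = (\<Prod>e\<leftarrow>es. [:- e, 1:])"
  shows "\<exists>V\<in>carrier_mat n n. transpose_mat V * V = 1\<^sub>m n \<and>
    transpose_mat V * A * V = mat_diag n (\<lambda>i. es ! i)"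
  using assms
proof (induction es arbitrary: n A)
  case Nil
  then have "n = 0" using degree_monic_char_poly[of A n] by simp
  then show ?case using Nil by (intro bexI[of _ "1\<^sub>m 0"]) (auto intro!: eq_matI simp: mat_diag_def)
next
  case (Cons e es n A)
  note A = Cons.prems(1) and sym = Cons.prems(2)
  let ?m = "n - 1"
  have cp: "char_poly A = [:- e, 1:] * (\<Prod>e\<leftarrow>es. [:- e, 1:])" using Cons.prems(3) by simp
  have "monic (\<Prod>e\<leftarrow>es. [:- e, 1:])" by (rule monic_prod_list) auto
  then have "degree (char_poly A) = Suc (degree (\<Prod>e\<leftarrow>es. [:- e, 1:]))"
    unfolding cp by (subst degree_mult_eq) auto
  then have n: "n > 0" using degree_monic_char_poly[OF A] by simp
  have "eigenvalue A e" unfolding eigenvalue_root_char_poly[OF A] cp by simp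
  then obtain v where v: "v \<in> carrier_vec n" "v \<noteq> 0\<^sub>v n" "A *\<^sub>v v = e \<cdot>\<^sub>v v"
    using A unfolding eigenvalue_def eigenvector_def by auto
  obtain W where W: "W \<in> carrier_mat n n" "transpose_mat W * W = 1\<^sub>m n"
    and W0: "col W 0 = (1 / sqrt (v \<bullet> v)) \<cdot>\<^sub>v v"
    using orthogonal_mat_first_col[OF v(1,2)] by blast
  have Wt: "transpose_mat W \<in> carrier_mat n n" using W by simp
  have WWt: "W * transpose_mat W = 1\<^sub>m n" using mat_mult_left_right_inverse[OF Wt W(1) W(2)] .
  define B where "B = transpose_mat W * A * W"
  have B: "B \<in> carrier_mat n n" using W A by (auto simp: B_def)
  have Bsym: "transpose_mat B = B"
    using W A sym transpose_mult[of "transpose_mat W * A" n n W n] transpose_mult[of "transpose_mat W" n n A n]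
    by (simp add: B_def assoc_mult_mat[of _ n n _ n _ n])
  \<comment> \<open>The first basis vector is an eigenvector, which clears the first column of
    \<open>B\<close>; symmetry clears the first row too, so \<open>B\<close> splits into
    \<open>e\<close> and a smaller symmetric block \<open>C\<close>.\<close>
  have "col B 0 = e \<cdot>\<^sub>v unit_vec n 0"
  proof -
    have "col B 0 = transpose_mat W *\<^sub>v (A *\<^sub>v col W 0)"
    proof -
      have "B = transpose_mat W * (A * W)" using Wt A W(1) by (simp add: B_def assoc_mult_mat[of _ n n _ n _ n])
      then show ?thesis
        using col_mult2[OF Wt mult_carrier_mat[OF A W(1)] n] col_mult2[OF A W(1) n] by simp
    qed
    also have "A *\<^sub>v col W 0 = e \<cdot>\<^sub>v col W 0"
      using v A by (simp add: W0 mult_mat_vec[of _ n n] smult_smult_assoc mult.commute)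
    also have "transpose_mat W *\<^sub>v (e \<cdot>\<^sub>v col W 0) = e \<cdot>\<^sub>v col (transpose_mat W * W) 0"
      using n W by (simp add: mult_mat_vec[of _ n n] col_mult2[OF Wt W(1), symmetric] del: col_mult2)
    also have "col (transpose_mat W * W) 0 = unit_vec n 0" using W(2) n by simp
    finally show ?thesis .
  qed
  then have B0: "B $$ (i, 0) = (if i = 0 then e else 0)" if "i < n" for i
    using that B n by (metis carrier_matD col_def index_smult_vec(1) index_unit_vec(1,3) index_vec mult_cancel_left1 mult_zero_right)
  have B0': "B $$ (0, j) = (if j = 0 then e else 0)" if "j < n" for j
    using B0[OF that] Bsym B n that by (metis carrier_matD index_transpose_mat(1))
  define C where "C = mat ?m ?m (\<lambda>(i, j). B $$ (Suc i, Suc j))"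
  have C: "C \<in> carrier_mat ?m ?m" by (simp add: C_def)
  have Bij: "B $$ (j, i) = B $$ (i, j)" if "i < n" "j < n" for i j
    using Bsym B that by (metis carrier_matD index_transpose_mat(1))
  have Csym: "transpose_mat C = C"
    by (rule eq_matI) (auto simp: C_def intro!: Bij)
  let ?E = "mat 1 1 (\<lambda>_. e)" and ?z1 = "0\<^sub>m 1 ?m" and ?z2 = "0\<^sub>m ?m 1"
  have Bblock: "B = four_block_mat ?E ?z1 ?z2 C"
    by (rule eq_matI) (use B n B0 B0' in \<open>auto simp: C_def\<close>)
  have "similar_mat_wit B A (transpose_mat W) W"
    by (rule similar_mat_witI[of _ _ n]) (use W WWt A B in \<open>auto simp: B_def\<close>)
  then have "char_poly B = char_poly A" using char_poly_similar unfolding similar_mat_def by blast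
  moreover have "char_poly B = char_poly ?E * char_poly C"
    unfolding Bblock by (rule char_poly_four_block_zeros_col) (use C in auto)
  moreover have "char_poly ?E = [:- e, 1:]"
    using char_poly_upper_triangular[of ?E 1] by (simp add: diag_mat_def upper_triangular_def)
  \<comment> \<open>The linear factor of \<open>e\<close> is cancelled on both sides, leaving the
    tail of the list for the induction hypothesis.\<close>
  ultimately have "char_poly C = (\<Prod>e\<leftarrow>es. [:- e, 1:])"
    by (metis cp mult_cancel_left pCons_eq_0_iff zero_neq_one)
  from Cons.IH[OF C Csym this] obtain V where V: "V \<in> carrier_mat ?m ?m" "transpose_mat V * V = 1\<^sub>m ?m"
    "transpose_mat V * C * V = mat_diag ?m (\<lambda>i. es ! i)" by blast
  let ?V = "four_block_mat (1\<^sub>m 1) ?z1 ?z2 V"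
  let ?Vt = "four_block_mat (1\<^sub>m 1) ?z1 ?z2 (transpose_mat V)"
  have Vc: "?V \<in> carrier_mat n n" "?Vt \<in> carrier_mat n n"
    using four_block_carrier_mat[of "1\<^sub>m 1" 1 1 V ?m ?m] four_block_carrier_mat[of "1\<^sub>m 1" 1 1 "transpose_mat V" ?m ?m] V n by auto
  have Vt: "transpose_mat ?V = ?Vt"
    using V transpose_four_block_mat[of "1\<^sub>m 1" 1 1 ?z1 ?m ?z2 ?m V] by simp
  have VtV: "?Vt * ?V = 1\<^sub>m n"
    using V n by (subst mult_four_block_mat[of _ 1 1 _ ?m _ ?m _ _ 1 _ ?m]) auto
  have VtB: "?Vt * B = four_block_mat ?E ?z1 ?z2 (transpose_mat V * C)"
    unfolding Bblock using V C by (subst mult_four_block_mat[of _ 1 1 _ ?m _ ?m _ _ 1 _ ?m]) auto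
  have VtBV: "?Vt * B * ?V = four_block_mat ?E ?z1 ?z2 (mat_diag ?m (\<lambda>i. es ! i))"
    unfolding VtB using V C by (subst mult_four_block_mat[of _ 1 1 _ ?m _ ?m _ _ 1 _ ?m]) auto
  have diag: "?Vt * B * ?V = mat_diag n (\<lambda>i. (e # es) ! i)"
    unfolding VtBV by (rule eq_matI) (use n in \<open>auto simp: mat_diag_def nth_Cons'\<close>)
  from Vc Vt VtV diag obtain X where X: "X \<in> carrier_mat n n" "transpose_mat X * X = 1\<^sub>m n"
    "transpose_mat X * B * X = mat_diag n (\<lambda>i. (e # es) ! i)"
    by metis
  have 1: "transpose_mat (W * X) * (W * X) = 1\<^sub>m n"
    using congruence_mult[OF W(1) X(1), of "1\<^sub>m n"] W Wt X(1)
    by (simp add: X(2) right_mult_one_mat[of "transpose_mat X" n n] right_mult_one_mat[of "transpose_mat (W * X)" n n])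
  have 2: "transpose_mat (W * X) * A * (W * X) = mat_diag n (\<lambda>i. (e # es) ! i)"
    using congruence_mult[OF W(1) X(1) A] X(3) by (simp add: B_def)
  show ?case using 1 2 W X by (intro bexI[of _ "W * X"]) auto
qed

lemma eigs_char_poly:
  assumes "char_poly A = (\<Prod>a\<leftarrow>as. [:- a, 1:])"
  shows "mset (eigs A) = mset as" "char_poly A = (\<Prod>a\<leftarrow>eigs A. [:- a, 1:])"
proof -
  have "proots (\<Prod>a\<leftarrow>as. [:- a, 1:]) = mset as"
  proof (induction as)
    case (Cons a as)
    have "(\<Prod>a\<leftarrow>as. [:- a, 1:]) \<noteq> 0" by (auto simp: prod_list_zero_iff)
    then show ?case using Cons proots_mult[of "[:- a, 1:]" "\<Prod>a\<leftarrow>as. [:- a, 1:]"]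
      by (simp del: mult_pCons_left)
  qed simp
  then show *: "mset (eigs A) = mset as" using assms by (simp add: eigs_def)
  then have "mset (map (\<lambda>a. [:- a, 1:]) (eigs A)) = mset (map (\<lambda>a. [:- a, 1:]) as)" by simp
  then show "char_poly A = (\<Prod>a\<leftarrow>eigs A. [:- a, 1:])"
    unfolding assms by (metis prod_mset_prod_list)
qed

lemma length_eigs:
  assumes A: "A \<in> carrier_mat n n" and sym: "transpose_mat A = A"
  shows "length (eigs A) = n"
proof -
  obtain as where as: "char_poly A = (\<Prod>a\<leftarrow>as. [:- a, 1:])"
    using real_symmetric_char_poly_splits[OF A sym] by blast
  have "degree (char_poly A) = length (eigs A)"
    using degree_linear_factors[of uminus "eigs A"] eigs_char_poly(2)[OF as] by simp
  then show ?thesis using degree_monic_char_poly[OF A] by simp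
qed

theorem spectral_theorem:
  fixes A :: "real mat"
  assumes A: "A \<in> carrier_mat n n" and sym: "transpose_mat A = A"
  obtains V where "V \<in> carrier_mat n n" "transpose_mat V * V = 1\<^sub>m n" "V * transpose_mat V = 1\<^sub>m n"
    "transpose_mat V * A * V = mat_diag n (\<lambda>i. eigs A ! i)"
    "A * V = V * mat_diag n (\<lambda>i. eigs A ! i)"
proof -
  obtain as where as: "char_poly A = (\<Prod>a\<leftarrow>as. [:- a, 1:])"
    using real_symmetric_char_poly_splits[OF A sym] by blast
  obtain V where V: "V \<in> carrier_mat n n" "transpose_mat V * V = 1\<^sub>m n"
    "transpose_mat V * A * V = mat_diag n (\<lambda>i. eigs A ! i)"
    using orthogonal_diagonalization[OF A sym eigs_char_poly(2)[OF as]] by blast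
  have Vt: "transpose_mat V \<in> carrier_mat n n" using V by simp
  have VVt: "V * transpose_mat V = 1\<^sub>m n" using mat_mult_left_right_inverse[OF Vt V(1,2)] .
  have "V * (transpose_mat V * A * V) = (V * transpose_mat V) * (A * V)"
    using V A Vt by (simp add: assoc_mult_mat[of _ n n _ n _ n])
  then have "A * V = V * mat_diag n (\<lambda>i. eigs A ! i)" using VVt V A by simp
  with V VVt that show ?thesis by blast
qed

section \<open>Matrix square roots and generalized eigenvectors\<close>

lemma smult_minus_distrib:
  fixes u v :: "real vec"
  assumes "v \<in> carrier_vec n" "u \<in> carrier_vec n"
  shows "(s * s) \<cdot>\<^sub>v v - s \<cdot>\<^sub>v u = - s \<cdot>\<^sub>v (u - s \<cdot>\<^sub>v v)"
  by (rule eq_vecI) (use assms in \<open>auto simp: right_diff_distrib\<close>)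

lemma smult_zero_vec_eq: "v \<in> carrier_vec n \<Longrightarrow> (0 :: real) \<cdot>\<^sub>v v = 0\<^sub>v n"
  by (rule eq_vecI) auto

lemma minus_vec_eq_0D:
  fixes u v :: "real vec"
  assumes "u \<in> carrier_vec n" "v \<in> carrier_vec n" "u - v = 0\<^sub>v n"
  shows "u = v"
proof (rule eq_vecI)
  fix i assume i: "i < dim_vec v"
  have "(u - v) $ i = 0" using assms i by simp
  then show "u $ i = v $ i" using assms(1,2) i by simp
qed (use assms in auto)

lemma congruence_entry:
  fixes A V :: "real mat"
  assumes "A \<in> carrier_mat n n" "V \<in> carrier_mat n m" "i < m" "j < m"
  shows "(transpose_mat V * A * V) $$ (i, j) = col V i \<bullet> (A *\<^sub>v col V j)"
proof -
  have Vt: "transpose_mat V \<in> carrier_mat m n" using assms by simp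
  have "transpose_mat V * A * V = transpose_mat V * (A * V)"
    using assms Vt by (simp add: assoc_mult_mat[of _ m n _ n _ m])
  moreover have "(transpose_mat V * (A * V)) $$ (i, j) = col V i \<bullet> col (A * V) j"
    using assms by (subst index_mult_mat) auto
  ultimately show ?thesis using col_mult2[OF assms(1,2,4)] by simp
qed

section \<open>Functional calculus in a fixed orthonormal basis\<close>

lemma mat_diag_mult_vec:
  "y \<in> carrier_vec n \<Longrightarrow> mat_diag n f *\<^sub>v y = vec n (\<lambda>i. f i * y $ i :: real)"
  by (rule eq_vecI) (auto simp: mat_diag_def scalar_prod_def if_distrib[of "\<lambda>x. x * _"] cong: if_cong)

lemma mat_diag_transpose: "transpose_mat (mat_diag n f) = mat_diag n f"
  by (rule eq_matI) (auto simp: mat_diag_def)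

lemma conjugated_mult_assoc:
  fixes V D E U :: "real mat"
  assumes [simp]: "V \<in> carrier_mat n n" "D \<in> carrier_mat n n" "E \<in> carrier_mat n n" "U \<in> carrier_mat n n"
  shows "V * D * U * (V * E * U) = V * D * (U * V) * (E * U)"
  by (simp add: assoc_mult_mat[of _ n n _ n _ n] mult_carrier_mat[of _ n n _ n])

text \<open>A function of a symmetric matrix with eigenbasis \<open>V\<close>. Here \<open>f\<close>
  acts on indices and not on eigenvalues, so repeated eigenvalues need no consistency check.\<close>

definition spec_fun :: "real mat \<Rightarrow> (nat \<Rightarrow> real) \<Rightarrow> real mat" where
  "spec_fun V f = V * mat_diag (dim_row V) f * transpose_mat V"

context
  fixes n :: nat and V :: "real mat"
  assumes V: "V \<in> carrier_mat n n" and VtV: "transpose_mat V * V = 1\<^sub>m n" and VVt: "V * transpose_mat V = 1\<^sub>m n"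
begin

lemma spec_fun_carrier: "spec_fun V f \<in> carrier_mat n n"
  using V by (auto simp: spec_fun_def)

lemma spec_fun_mult: "spec_fun V f * spec_fun V g = spec_fun V (\<lambda>i. f i * g i)"
proof -
  have Vt: "transpose_mat V \<in> carrier_mat n n" using V by simp
  have "spec_fun V f * spec_fun V g
    = V * mat_diag n f * (transpose_mat V * V) * (mat_diag n g * transpose_mat V)"
    using conjugated_mult_assoc[OF V mat_diag_dim mat_diag_dim Vt] V by (simp add: spec_fun_def)
  also have "\<dots> = V * (mat_diag n f * mat_diag n g) * transpose_mat V"
    using V Vt unfolding VtV
    by (simp add: assoc_mult_mat[of _ n n _ n _ n] mult_carrier_mat[of _ n n _ n] right_mult_one_mat[of _ n n] del: mat_diag_diag)
  finally show ?thesis using V by (simp add: spec_fun_def)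
qed

lemma spec_fun_transpose: "transpose_mat (spec_fun V f) = spec_fun V f"
proof -
  have Vt: "transpose_mat V \<in> carrier_mat n n" using V by simp
  have VD: "V * mat_diag n f \<in> carrier_mat n n" using V by auto
  have "transpose_mat (V * mat_diag n f * transpose_mat V) = V * (mat_diag n f * transpose_mat V)"
    unfolding transpose_mult[OF VD Vt] transpose_mult[OF V mat_diag_dim] by (simp add: mat_diag_transpose)
  then show ?thesis using V Vt by (simp add: spec_fun_def assoc_mult_mat[of _ n n _ n _ n])
qed

lemma spec_fun_one: "spec_fun V (\<lambda>_. 1) = 1\<^sub>m n"
  using V VVt by (simp add: spec_fun_def)

lemma spec_fun_quadratic:
  assumes x: "x \<in> carrier_vec n"
  shows "x \<bullet> (spec_fun V f *\<^sub>v x) = (\<Sum>i<n. f i * ((transpose_mat V *\<^sub>v x) $ i)\<^sup>2)"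
proof -
  let ?y = "transpose_mat V *\<^sub>v x"
  have y: "?y \<in> carrier_vec n" using V x by simp
  have "spec_fun V f *\<^sub>v x = V *\<^sub>v (mat_diag n f *\<^sub>v ?y)"
    using V x by (simp add: spec_fun_def assoc_mult_mat_vec[of _ n n _ n])
  then have "x \<bullet> (spec_fun V f *\<^sub>v x) = ?y \<bullet> (mat_diag n f *\<^sub>v ?y)"
    using transpose_vec_mult_scalar[of "transpose_mat V" n n x "mat_diag n f *\<^sub>v ?y"]
      comm_scalar_prod[of x n] transpose_vec_mult_scalar[of V n n "mat_diag n f *\<^sub>v ?y" x] V x y
    by (metis mat_diag_dim mult_mat_vec_carrier)
  then show ?thesis using y
    by (simp add: mat_diag_mult_vec scalar_prod_def atLeast0LessThan power2_eq_square mult_ac)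
qed

lemma spec_fun_psd: "(\<And>i. i < n \<Longrightarrow> 0 \<le> f i) \<Longrightarrow> sym_psd n (spec_fun V f)"
  unfolding sym_psd_def using spec_fun_carrier spec_fun_transpose
  by (auto simp: spec_fun_quadratic intro!: sum_nonneg)

lemma spec_fun_eqI:
  assumes A: "A \<in> carrier_mat n n" and AV: "A * V = V * mat_diag n f"
  shows "A = spec_fun V f"
proof -
  have Vt: "transpose_mat V \<in> carrier_mat n n" using V by simp
  have "A = A * (V * transpose_mat V)" using A by (simp add: VVt)
  also have "\<dots> = A * V * transpose_mat V" using A V Vt by (simp add: assoc_mult_mat[of _ n n _ n _ n])
  finally show ?thesis using V AV by (simp add: spec_fun_def)
qed

end

text \<open>A left inverse of a square matrix is also a right inverse, hence unique, so the choice
  in \<open>mat_inv\<close> is forced.\<close>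

lemma mat_inv_eq:
  assumes A: "A \<in> carrier_mat n n" and B: "B \<in> carrier_mat n n" and BA: "B * A = 1\<^sub>m n"
  shows "mat_inv A = B"
  unfolding mat_inv_def
proof (rule some_equality)
  show "B \<in> carrier_mat (dim_row A) (dim_row A) \<and> B * A = 1\<^sub>m (dim_row A)" using assms by auto
  fix C assume "C \<in> carrier_mat (dim_row A) (dim_row A) \<and> C * A = 1\<^sub>m (dim_row A)"
  then have C: "C \<in> carrier_mat n n" "C * A = 1\<^sub>m n" using A by auto
  have AB: "A * B = 1\<^sub>m n" using mat_mult_left_right_inverse[OF B A BA] .
  have "C = C * (A * B)" using AB C by simp
  also have "\<dots> = (C * A) * B" using assoc_mult_mat[OF C(1) A B] by simp
  finally show "C = B" using B C by simp
qed

text \<open>For an eigenvector v of \<open>S\<close> with eigenvalue s, (T + s) (T - s) v = 0. Hence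
  w = T v - s v satisfies T w = - s w, which positivity of \<open>T\<close> permits only for w = 0
  or s = 0. So \<open>T\<close> acts on an eigenbasis of \<open>S\<close> just as \<open>S\<close>
  does.\<close>

lemma psd_sqrt_unique:
  assumes S: "sym_psd n S" and T: "sym_psd n T" and eq: "S * S = T * T"
  shows "S = T"
proof -
  have Sc: "S \<in> carrier_mat n n" "transpose_mat S = S" and Tc: "T \<in> carrier_mat n n" "transpose_mat T = T"
    using S T by (auto simp: sym_psd_def)
  obtain V where V: "V \<in> carrier_mat n n" "transpose_mat V * V = 1\<^sub>m n" "V * transpose_mat V = 1\<^sub>m n"
    "transpose_mat V * S * V = mat_diag n (\<lambda>i. eigs S ! i)" "S * V = V * mat_diag n (\<lambda>i. eigs S ! i)"
    using spectral_theorem[OF Sc] .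
  have "T * V = V * mat_diag n (\<lambda>i. eigs S ! i)"
  proof (rule mat_col_eqI)
    fix i assume "i < dim_col (V * mat_diag n (\<lambda>i. eigs S ! i))"
    then have i: "i < n" by (simp add: mat_diag_def)
    let ?v = "col V i" and ?s = "eigs S ! i"
    have v: "?v \<in> carrier_vec n" using V i by simp
    have VD: "col (V * mat_diag n (\<lambda>i. eigs S ! i)) i = ?s \<cdot>\<^sub>v ?v"
      by (rule eq_vecI) (use V i in \<open>auto simp: mat_diag_mult_right[of _ n]\<close>)
    have Sv: "S *\<^sub>v ?v = ?s \<cdot>\<^sub>v ?v" using VD V(1,5) Sc i by (metis col_mult2)
    have s: "?s \<ge> 0"
    proof -
      have "?s = ?v \<bullet> (S *\<^sub>v ?v)" using congruence_entry[OF Sc(1) V(1) i i] V(4) i by (simp add: mat_diag_def)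
      then show ?thesis using S v by (simp add: sym_psd_def)
    qed
    have "T *\<^sub>v (T *\<^sub>v ?v) = S *\<^sub>v (S *\<^sub>v ?v)" using eq Sc Tc v by (metis assoc_mult_mat_vec)
    also have "\<dots> = (?s * ?s) \<cdot>\<^sub>v ?v" using Sv Sc v by (simp add: mult_mat_vec[of _ n n] smult_smult_assoc)
    finally have TT: "T *\<^sub>v (T *\<^sub>v ?v) = (?s * ?s) \<cdot>\<^sub>v ?v" .
    define w where "w = T *\<^sub>v ?v - ?s \<cdot>\<^sub>v ?v"
    have w: "w \<in> carrier_vec n" using v Tc by (simp add: w_def)
    have Tv: "T *\<^sub>v ?v \<in> carrier_vec n" using v Tc by simp
    have Tw: "T *\<^sub>v w = - ?s \<cdot>\<^sub>v w"
      unfolding w_def mult_minus_distrib_mat_vec[OF Tc(1) Tv smult_carrier_vec[THEN iffD2, OF v]] TT mult_mat_vec[OF Tc(1) v]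
      by (rule smult_minus_distrib[OF v Tv])
    have "w = 0\<^sub>v n"
    proof (rule ccontr)
      assume "w \<noteq> 0\<^sub>v n"
      then have pos: "w \<bullet> w > 0" using sprod_self_pos w by blast
      have "0 \<le> w \<bullet> (T *\<^sub>v w)" using T w by (simp add: sym_psd_def)
      then have "?s * (w \<bullet> w) \<le> 0" using Tw w by simp
      then have "?s = 0" using pos s by (metis mult_pos_pos not_le order_le_less)
      \<comment> \<open>The remaining case s = 0: w is then both in the image and in the kernel of
        the symmetric \<open>T\<close>, so it is orthogonal to itself.\<close>
      have "w = T *\<^sub>v ?v" "T *\<^sub>v w = 0\<^sub>v n"
        using smult_zero_vec_eq[OF v] smult_zero_vec_eq[OF w] Tw minus_zero_vec[OF Tv] \<open>?s = 0\<close> by (simp_all add: w_def)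
      then have "w \<bullet> w = ?v \<bullet> 0\<^sub>v n" using sprod_assoc_sym[OF Tc v w] by simp
      then show False using pos v by simp
    qed
    then have "T *\<^sub>v ?v = ?s \<cdot>\<^sub>v ?v"
      unfolding w_def using minus_vec_eq_0D[OF Tv] v by simp
    then show "col (T * V) i = col (V * mat_diag n (\<lambda>i. eigs S ! i)) i"
      unfolding VD using col_mult2[OF Tc(1) V(1) i] by simp
  qed (use Tc V in \<open>auto simp: mat_diag_def\<close>)
  then show ?thesis
    using spec_fun_eqI[OF V(1-3) Tc(1)] spec_fun_eqI[OF V(1-3) Sc(1) V(5)] by simp
qed

lemma mat_sqrt_eq:
  assumes S: "sym_psd n S"
  shows "mat_sqrt (S * S) = S"
proof -
  have "dim_row (S * S) = n" using S by (auto simp: sym_psd_def)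
  then show ?thesis unfolding mat_sqrt_def using S psd_sqrt_unique[OF _ S]
    by (intro the_equality) simp_all
qed

text \<open>In an eigenbasis of \<open>P\<close> every claim becomes an identity between powers of
  the eigenvalues, which positivity makes legitimate.\<close>

lemma inverse_sqrt:
  fixes P :: "real mat"
  assumes P: "P \<in> carrier_mat n n" "transpose_mat P = P"
    and pos: "\<And>x. x \<in> carrier_vec n \<Longrightarrow> x \<noteq> 0\<^sub>v n \<Longrightarrow> 0 < x \<bullet> (P *\<^sub>v x)"
  defines "S \<equiv> mat_inv (mat_sqrt P)"
  shows "S \<in> carrier_mat n n" "transpose_mat S = S" "S * P * S = 1\<^sub>m n" "mat_inv P = S * S"
    "mat_inv P * P = 1\<^sub>m n" "P * mat_inv P = 1\<^sub>m n"
proof -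
  obtain V where V: "V \<in> carrier_mat n n" "transpose_mat V * V = 1\<^sub>m n" "V * transpose_mat V = 1\<^sub>m n"
    "transpose_mat V * P * V = mat_diag n (\<lambda>i. eigs P ! i)" "P * V = V * mat_diag n (\<lambda>i. eigs P ! i)"
    using spectral_theorem[OF P] .
  let ?e = "\<lambda>i. eigs P ! i"
  have e: "?e i > 0" if i: "i < n" for i
  proof -
    have v: "col V i \<in> carrier_vec n" using V i by simp
    have "col V i \<bullet> col V i = 1"
      using congruence_entry[OF one_carrier_mat V(1) i i] V v i by simp
    then have "col V i \<noteq> 0\<^sub>v n" by auto
    then show ?thesis
      using pos[OF v] congruence_entry[OF P(1) V(1) i i] V(4) i by (simp add: mat_diag_def)
  qed
  note sf = spec_fun_mult[OF V(1-3)]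
  have cong: "spec_fun V f = spec_fun V g" if "\<And>i. i < n \<Longrightarrow> f i = g i" for f g
  proof -
    have "mat_diag n f = mat_diag n g" using that by (auto simp: mat_diag_def intro!: eq_matI)
    then show ?thesis using V(1) by (simp add: spec_fun_def)
  qed
  have PV: "P = spec_fun V ?e" by (rule spec_fun_eqI[OF V(1-3) P(1) V(5)])
  have "P = spec_fun V (\<lambda>i. sqrt (?e i)) * spec_fun V (\<lambda>i. sqrt (?e i))"
    unfolding sf by (subst PV, rule cong) (use e in \<open>simp add: less_imp_le\<close>)
  then have Q: "mat_sqrt P = spec_fun V (\<lambda>i. sqrt (?e i))"
    using mat_sqrt_eq[OF spec_fun_psd[OF V(1-3)], of "\<lambda>i. sqrt (?e i)"] e by (simp add: less_imp_le)
  have "spec_fun V (\<lambda>i. 1 / sqrt (?e i)) * mat_sqrt P = spec_fun V (\<lambda>_. 1)"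
    unfolding Q sf by (rule cong) (use e in \<open>simp add: less_imp_neq[symmetric]\<close>)
  then have S: "S = spec_fun V (\<lambda>i. 1 / sqrt (?e i))"
    unfolding S_def Q by (intro mat_inv_eq[OF spec_fun_carrier[OF V(1-3)] spec_fun_carrier[OF V(1-3)]])
      (simp add: spec_fun_one[OF V(1-3)])
  show Sc: "S \<in> carrier_mat n n" unfolding S by (rule spec_fun_carrier[OF V(1-3)])
  show "transpose_mat S = S" unfolding S by (rule spec_fun_transpose[OF V(1-3)])
  have "S * P * S = spec_fun V (\<lambda>_. 1)"
    unfolding S by (subst PV, unfold sf, rule cong) (use e in \<open>simp add: less_imp_neq[symmetric] field_simps less_imp_le\<close>)
  then show "S * P * S = 1\<^sub>m n" by (simp add: spec_fun_one[OF V(1-3)])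
  have "S * S * P = spec_fun V (\<lambda>_. 1)"
    unfolding S by (subst PV, unfold sf, rule cong) (use e in \<open>simp add: less_imp_neq[symmetric] field_simps less_imp_le\<close>)
  then have SSP: "S * S * P = 1\<^sub>m n" by (simp add: spec_fun_one[OF V(1-3)])
  have SS: "S * S \<in> carrier_mat n n" using Sc by simp
  show inv: "mat_inv P = S * S" by (rule mat_inv_eq[OF P(1) SS SSP])
  show "mat_inv P * P = 1\<^sub>m n" using SSP inv by simp
  show "P * mat_inv P = 1\<^sub>m n" unfolding inv by (rule mat_mult_left_right_inverse[OF SS P(1) SSP])
qed

text \<open>The columns of \<open>W\<close> are generalized eigenvectors, \<open>A w = e P w\<close>, which are orthonormal for
  \<open>P\<close> and orthogonal for \<open>A\<close>.\<close>

lemma preconditioned_spectrum: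
  fixes A P :: "real mat"
  assumes A: "A \<in> carrier_mat n n" "transpose_mat A = A"
    and P: "P \<in> carrier_mat n n" "transpose_mat P = P"
    and pos: "\<And>x. x \<in> carrier_vec n \<Longrightarrow> x \<noteq> 0\<^sub>v n \<Longrightarrow> 0 < x \<bullet> (P *\<^sub>v x)"
    and lower: "\<And>x. x \<in> carrier_vec n \<Longrightarrow> x \<bullet> (P *\<^sub>v x) \<le> x \<bullet> (A *\<^sub>v x)"
    and upper: "\<And>x. x \<in> carrier_vec n \<Longrightarrow> x \<bullet> (A *\<^sub>v x) \<le> \<kappa> * (x \<bullet> (P *\<^sub>v x))"
  defines "M \<equiv> mat_inv (mat_sqrt P) * A * mat_inv (mat_sqrt P)"
  shows "length (eigs M) = n"
    and "\<And>i. i < n \<Longrightarrow> 1 \<le> eigs M ! i \<and> eigs M ! i \<le> \<kappa>"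
    and "\<exists>W \<in> carrier_mat n n. transpose_mat W * A * W = mat_diag n (\<lambda>i. eigs M ! i) \<and>
      mat_inv P * A * W = W * mat_diag n (\<lambda>i. eigs M ! i) \<and> (\<exists>X \<in> carrier_mat n n. W * X = 1\<^sub>m n)"
proof -
  define S where "S = mat_inv (mat_sqrt P)"
  note S = inverse_sqrt[OF P pos, folded S_def]
  have M: "M = transpose_mat S * A * S" by (simp add: M_def S_def[symmetric] S)
  have Mc: "M \<in> carrier_mat n n" using S A by (simp add: M)
  have Msym: "transpose_mat M = M"
    using S A transpose_mult[of "S * A" n n S n] transpose_mult[of S n n A n]
    by (simp add: M assoc_mult_mat[of _ n n _ n _ n])
  show "length (eigs M) = n" by (rule length_eigs[OF Mc Msym])
  obtain V where V: "V \<in> carrier_mat n n" "transpose_mat V * V = 1\<^sub>m n" "V * transpose_mat V = 1\<^sub>m n"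
    "transpose_mat V * M * V = mat_diag n (\<lambda>i. eigs M ! i)" "M * V = V * mat_diag n (\<lambda>i. eigs M ! i)"
    using spectral_theorem[OF Mc Msym] .
  \<comment> \<open>This basis turns \<open>P\<close> into the identity and \<open>A\<close> into a
    diagonal matrix at once. On a column of \<open>W\<close> the form of \<open>P\<close> is 1 and
    that of \<open>A\<close> is an eigenvalue of \<open>M\<close>, so \<open>lower\<close> and
    \<open>upper\<close> become eigenvalue bounds.\<close>
  define W where "W = S * V"
  have W: "W \<in> carrier_mat n n" using S V by (simp add: W_def)
  have WA: "transpose_mat W * A * W = mat_diag n (\<lambda>i. eigs M ! i)"
    using congruence_mult[OF S(1) V(1) A(1)] V(4) by (simp add: W_def M)
  have Vt: "transpose_mat V \<in> carrier_mat n n" using V by simp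
  have WP: "transpose_mat W * P * W = 1\<^sub>m n"
    using congruence_mult[OF S(1) V(1) P(1)] S(2,3) V(2) Vt by (simp add: W_def right_mult_one_mat[OF Vt])
  show "1 \<le> eigs M ! i \<and> eigs M ! i \<le> \<kappa>" if i: "i < n" for i
  proof -
    have w: "col W i \<in> carrier_vec n" using W i by simp
    have "col W i \<bullet> (A *\<^sub>v col W i) = eigs M ! i" "col W i \<bullet> (P *\<^sub>v col W i) = 1"
      using congruence_entry[OF A(1) W i i] congruence_entry[OF P(1) W i i] WA WP i by (auto simp: mat_diag_def)
    then show ?thesis using lower[OF w] upper[OF w] by simp
  qed
  have WD: "mat_inv P * A * W = W * mat_diag n (\<lambda>i. eigs M ! i)"
  proof -
    have "mat_inv P * A * W = S * (S * A * S * V)"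
      using S(1) V(1) A(1) by (simp add: S(4) W_def assoc_mult_mat[of _ n n _ n _ n])
    also have "S * A * S * V = V * mat_diag n (\<lambda>i. eigs M ! i)" using V(5) by (simp add: M S(2))
    finally show ?thesis using S(1) V(1) by (simp add: W_def assoc_mult_mat[of _ n n _ n _ n])
  qed
  have "transpose_mat W * P \<in> carrier_mat n n" using W P by simp
  moreover have "W * (transpose_mat W * P) = 1\<^sub>m n"
    using mat_mult_left_right_inverse[OF _ W WP] W P by simp
  ultimately show "\<exists>W \<in> carrier_mat n n. transpose_mat W * A * W = mat_diag n (\<lambda>i. eigs M ! i) \<and>
      mat_inv P * A * W = W * mat_diag n (\<lambda>i. eigs M ! i) \<and> (\<exists>X \<in> carrier_mat n n. W * X = 1\<^sub>m n)"
    using W WA WD by blast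
qed

lemma cond_num_le:
  assumes "length (eigs M) = n" "n > 0" "\<And>i. i < n \<Longrightarrow> 1 \<le> eigs M ! i \<and> eigs M ! i \<le> \<kappa>"
  shows "cond_num M \<le> \<kappa>"
proof -
  have "eigs M \<noteq> []" using assms by auto
  then have "hd (eigs M) = eigs M ! 0" "last (eigs M) = eigs M ! (n - 1)"
    using assms by (auto simp: hd_conv_nth last_conv_nth)
  then have "hd (eigs M) \<le> \<kappa>" "0 \<le> hd (eigs M)" "1 \<le> last (eigs M)" using assms(2) assms(3)[of 0] assms(3)[of "n - 1"] by auto
  then show ?thesis using frac_le[of \<kappa> "hd (eigs M)" 1 "last (eigs M)"] by (simp add: cond_num_def)
qed

section \<open>Chebyshev polynomials\<close>

fun cheb :: "nat \<Rightarrow> real poly" where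
  "cheb 0 = 1"
| "cheb (Suc 0) = [:0, 1:]"
| "cheb (Suc (Suc k)) = [:0, 2:] * cheb (Suc k) - cheb k"

lemma degree_cheb: "degree (cheb k) \<le> k"
proof (induction k rule: cheb.induct)
  case (3 k)
  have "degree ([:0, 2:] * cheb (Suc k)) \<le> Suc (Suc k)"
    using degree_mult_le[of "[:0, 2:]" "cheb (Suc k)"] 3 by simp
  then show ?case using 3 by (simp add: degree_diff_le del: mult_pCons_left)
qed simp_all

lemma cheb_cos: "poly (cheb k) (cos \<theta>) = cos (real k * \<theta>)"
proof (induction k rule: cheb.induct)
  case (3 k)
  have "cos (real (Suc (Suc k)) * \<theta>) + cos (real k * \<theta>)
    = cos (real (Suc k) * \<theta> + \<theta>) + cos (real (Suc k) * \<theta> - \<theta>)"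
    by (simp add: algebra_simps)
  also have "\<dots> = 2 * cos \<theta> * cos (real (Suc k) * \<theta>)" by (simp only: cos_add cos_diff) simp
  finally show ?case using 3 by (simp add: algebra_simps)
qed simp_all

lemma cheb_abs_le_1: "\<bar>x\<bar> \<le> 1 \<Longrightarrow> \<bar>poly (cheb k) x\<bar> \<le> 1"
  using cheb_cos[of k "arccos x"] by (simp add: cos_arccos_abs)

text \<open>Gives the values outside [-1, 1], which the cosine formula does not reach: under x = (y
  + 1 / y) / 2 the powers of y and of 1 / y both solve the three-term recurrence.\<close>

lemma cheb_joukowski: "y \<noteq> 0 \<Longrightarrow> poly (cheb k) ((y + 1 / y) / 2) = (y ^ k + (1 / y) ^ k) / 2"
proof (induction k rule: cheb.induct)
  case (3 k)
  define z where "z = 1 / y"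
  have z: "y * z ^ Suc k = z ^ k" "z * y ^ Suc k = y ^ k" using 3 by (simp_all add: z_def field_simps)
  have IH: "poly (cheb (Suc k)) ((y + z) / 2) = (y ^ Suc k + z ^ Suc k) / 2"
    "poly (cheb k) ((y + z) / 2) = (y ^ k + z ^ k) / 2"
    using 3(1)[OF 3(3)] 3(2)[OF 3(3)] by (simp_all only: z_def)
  have "poly (cheb (Suc (Suc k))) ((y + z) / 2)
    = (y + z) * ((y ^ Suc k + z ^ Suc k) / 2) - (y ^ k + z ^ k) / 2"
    by (simp add: IH del: power_Suc)
  also have "\<dots> = (y * y ^ Suc k + y * z ^ Suc k + z * y ^ Suc k + z * z ^ Suc k - (y ^ k + z ^ k)) / 2"
    by (simp add: field_simps del: power_Suc)
  also have "\<dots> = (y ^ Suc (Suc k) + z ^ Suc (Suc k)) / 2" unfolding z by simp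
  finally show ?case by (simp only: z_def)
qed simp_all

lemma shifted_cheb_bound:
  assumes \<kappa>: "1 < \<kappa>"
  shows "\<exists>p :: real poly. degree p \<le> t \<and> poly p 0 = 1 \<and>
    (\<forall>x. 1 \<le> x \<and> x \<le> \<kappa> \<longrightarrow> \<bar>poly p x\<bar> \<le> 2 * ((sqrt \<kappa> - 1) / (sqrt \<kappa> + 1)) ^ t)"
proof -
  let ?s = "sqrt \<kappa>"
  have s: "1 < ?s" "?s * ?s = \<kappa>" using \<kappa> by auto
  \<comment> \<open>The solution of (y + 1 / y) / 2 = (\<kappa> + 1) / (\<kappa> - 1), which is the
    point to which the affine map \<open>?l\<close> below sends 0.\<close>
  define y where "y = (?s + 1) / (?s - 1)"
  have y: "y > 0" using s unfolding y_def by (intro divide_pos_pos add_pos_pos) auto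
  have y': "1 / y = (?s - 1) / (?s + 1)" by (simp add: y_def)
  have "(y + 1 / y) / 2 = ((?s + 1) * (?s + 1) + (?s - 1) * (?s - 1)) / (2 * ((?s - 1) * (?s + 1)))"
    using s(1) by (simp add: y_def divide_simps)
  also have "\<dots> = (2 * (\<kappa> + 1)) / (2 * (\<kappa> - 1))" using s(2) by (simp add: algebra_simps)
  also have "\<dots> = (\<kappa> + 1) / (\<kappa> - 1)" by (rule mult_divide_mult_cancel_left) simp
  finally have j: "(y + 1 / y) / 2 = (\<kappa> + 1) / (\<kappa> - 1)" .
  define T where "T = poly (cheb t) ((\<kappa> + 1) / (\<kappa> - 1))"
  have T: "T = (y ^ t + (1 / y) ^ t) / 2" using cheb_joukowski[of y t] y j by (simp add: T_def)
  \<comment> \<open>Dropping (1 / y) ^ t is what produces the factor 2 in the bound.\<close>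
  have Tge: "T \<ge> y ^ t / 2" using y by (simp add: T)
  have Tpos: "T > 0" using y by (auto simp: T intro!: divide_pos_pos add_pos_pos)
  \<comment> \<open>The decreasing affine map from [1, \<kappa>] onto [-1, 1]; division by
    \<open>T\<close> then normalizes the value at 0 to 1.\<close>
  let ?l = "[:(\<kappa> + 1) / (\<kappa> - 1), - 2 / (\<kappa> - 1):]"
  define p where "p = Polynomial.smult (1 / T) (pcompose (cheb t) ?l)"
  have "degree p \<le> degree (cheb t) * degree ?l" using Tpos by (simp add: p_def)
  also have "\<dots> \<le> t" using degree_cheb[of t] \<kappa> by simp
  finally have deg: "degree p \<le> t" .
  have p0: "poly p 0 = 1" using Tpos by (simp add: p_def poly_pcompose T_def[symmetric])
  have "\<bar>poly p x\<bar> \<le> 2 * ((?s - 1) / (?s + 1)) ^ t" if x: "1 \<le> x" "x \<le> \<kappa>" for x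
  proof -
    have "poly ?l x = (\<kappa> + 1 - 2 * x) / (\<kappa> - 1)" by (simp add: diff_divide_distrib)
    moreover have "\<bar>(\<kappa> + 1 - 2 * x) / (\<kappa> - 1)\<bar> \<le> 1" using x \<kappa> by (simp add: abs_le_iff divide_simps)
    ultimately have "\<bar>poly ?l x\<bar> \<le> 1" by simp
    then have "\<bar>poly p x\<bar> \<le> 1 / T"
      using cheb_abs_le_1[of "poly ?l x" t] Tpos by (simp add: p_def poly_pcompose abs_mult divide_right_mono del: poly_pCons)
    also have "\<dots> \<le> 1 / (y ^ t / 2)" using Tge y Tpos by (intro divide_left_mono) auto
    also have "\<dots> = 2 * (1 / y) ^ t" by (simp add: power_divide)
    finally show ?thesis using y' by simp
  qed
  then show ?thesis using deg p0 by blast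
qed

text \<open>First term of the series of 2 artanh u; the difference of the two sides has derivative 2
  x^2 / (1 - x^2).\<close>

lemma ln_ratio_ge:
  fixes u :: real
  assumes u: "0 \<le> u" "u < 1"
  shows "2 * u \<le> ln ((1 + u) / (1 - u))"
proof -
  let ?g = "\<lambda>u :: real. ln (1 + u) - ln (1 - u) - 2 * u"
  have "?g 0 \<le> ?g u"
  proof (rule DERIV_nonneg_imp_nondecreasing[OF u(1)])
    fix x assume x: "0 \<le> x" "x \<le> u"
    have "(?g has_real_derivative (1 / (1 + x) + 1 / (1 - x) - 2)) (at x)"
      using x u by (auto intro!: derivative_eq_intros)
    moreover have "1 / (1 + x) + 1 / (1 - x) - 2 = 2 * x\<^sup>2 / ((1 + x) * (1 - x))"
      using x u by (simp add: divide_simps) (simp add: algebra_simps power2_eq_square)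
    moreover have "0 \<le> 2 * x\<^sup>2 / ((1 + x) * (1 - x))" using x u by simp
    ultimately show "\<exists>y. (?g has_real_derivative y) (at x) \<and> 0 \<le> y" by metis
  qed
  then show ?thesis using u by (simp add: ln_div)
qed

text \<open>Since \<delta> + 2 \<le> 4, \<open>s\<close> is at most 2 / sqrt \<delta>; the estimate
  \<open>ln_ratio_ge\<close> is used at u = 1 / s.\<close>

lemma cheb_rate_le:
  assumes \<delta>: "0 < \<delta>" "\<delta> < 1" and \<epsilon>: "0 < \<epsilon>" "\<epsilon> < 1"
    and t: "real t \<ge> \<delta> powr (-1/2) * ln (2 / \<epsilon>)"
  defines "s \<equiv> sqrt (1 + 2 / \<delta>)"
  shows "2 * ((s - 1) / (s + 1)) ^ t \<le> \<epsilon>"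
proof -
  have s1: "1 < s" using \<delta> by (simp add: s_def)
  have "\<delta> powr (-1/2) = 1 / sqrt \<delta>" using \<delta> by (simp add: powr_minus_divide powr_half_sqrt)
  moreover have "s \<le> 2 * (1 / sqrt \<delta>)"
  proof -
    have "s = sqrt ((\<delta> + 2) / \<delta>)" using \<delta> by (simp add: s_def field_simps)
    also have "\<dots> \<le> sqrt (4 / \<delta>)" using \<delta> by (intro real_sqrt_le_mono divide_right_mono) auto
    finally show ?thesis by (simp add: real_sqrt_divide)
  qed
  ultimately have s: "s \<le> 2 * \<delta> powr (-1/2)" by simp
  have l: "ln (2 / \<epsilon>) > 0" using \<epsilon> by simp
  have "s * ln (2 / \<epsilon>) \<le> 2 * (\<delta> powr (-1/2) * ln (2 / \<epsilon>))" using s l by (simp add: mult.assoc[symmetric])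
  also have "\<dots> \<le> 2 * real t" using t by simp
  finally have tl: "ln (2 / \<epsilon>) \<le> real t * (2 * (1 / s))" using s1 by (simp add: field_simps)
  have q: "0 < (s + 1) / (s - 1)" using s1 by simp
  have "(1 + 1 / s) / (1 - 1 / s) = (s + 1) / (s - 1)" using s1 by (simp add: field_simps)
  then have "2 * (1 / s) \<le> ln ((s + 1) / (s - 1))" using ln_ratio_ge[of "1 / s"] s1 by simp
  then have "ln (2 / \<epsilon>) \<le> real t * ln ((s + 1) / (s - 1))"
    using tl by (meson mult_left_mono of_nat_0_le_iff order_trans)
  also have "\<dots> = ln (((s + 1) / (s - 1)) ^ t)" using q by (simp add: ln_realpow)
  finally have "2 / \<epsilon> \<le> ((s + 1) / (s - 1)) ^ t" using q \<epsilon> by simp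
  then have "2 \<le> \<epsilon> * ((s + 1) / (s - 1)) ^ t" using \<epsilon> by (simp add: field_simps)
  then have "2 * ((s - 1) / (s + 1)) ^ t \<le> \<epsilon> * (((s + 1) / (s - 1)) ^ t * ((s - 1) / (s + 1)) ^ t)"
    using mult_right_mono[of 2 _ "((s - 1) / (s + 1)) ^ t"] s1 by (simp add: mult.assoc)
  also have "((s + 1) / (s - 1)) ^ t * ((s - 1) / (s + 1)) ^ t = 1"
    using s1 by (simp add: power_mult_distrib[symmetric])
  finally show ?thesis by simp
qed

section \<open>Preconditioned conjugate gradients\<close>

lemma vec_add_sub_cancel:
  fixes u v w :: "real vec"
  assumes "u \<in> carrier_vec n" "v \<in> carrier_vec n" "w \<in> carrier_vec n"
  shows "u + w + (v - w) = u + v"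
  by (rule eq_vecI) (use assms in auto)

lemma vec_eq_diff:
  fixes u v w :: "real vec"
  assumes "u \<in> carrier_vec n" "v \<in> carrier_vec n" "w = u + v"
  shows "w - v = u" "w - u = v"
  by (rule eq_vecI; use assms in auto)+

lemma vec_diff_add_diff:
  fixes u v w :: "real vec"
  assumes "u \<in> carrier_vec n" "v \<in> carrier_vec n" "w \<in> carrier_vec n"
  shows "u - w = (u - v) + (v - w)"
  by (rule eq_vecI) (use assms in auto)

text \<open>The iteration sees the preconditioner only through \<open>mat_inv P\<close>, abbreviated
  by \<open>W\<close>, so symmetry and positivity are assumed of that matrix directly.\<close>

locale pcg_run =
  fixes n :: nat and A P W :: "real mat" and b :: "real vec"
  assumes A: "A \<in> carrier_mat n n" "transpose_mat A = A"
    and Apos: "\<And>x. x \<in> carrier_vec n \<Longrightarrow> x \<noteq> 0\<^sub>v n \<Longrightarrow> 0 < x \<bullet> (A *\<^sub>v x)"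
    and W: "mat_inv P \<in> carrier_mat n n" "transpose_mat (mat_inv P) = mat_inv P"
    and Wpos: "\<And>x. x \<in> carrier_vec n \<Longrightarrow> x \<noteq> 0\<^sub>v n \<Longrightarrow> 0 < x \<bullet> (mat_inv P *\<^sub>v x)"
    and b: "b \<in> carrier_vec n"
    and W_def: "W = mat_inv P"
begin

definition "d k = fst (pcg_state A P b k)"
definition "r k = fst (snd (pcg_state A P b k))"
definition "z k = fst (snd (snd (pcg_state A P b k)))"
definition "p k = snd (snd (snd (pcg_state A P b k)))"
definition "\<alpha> k = (r k \<bullet> z k) / (p k \<bullet> (A *\<^sub>v p k))"
definition "\<beta> k = (r (Suc k) \<bullet> z (Suc k)) / (r k \<bullet> z k)"

lemma W': "W \<in> carrier_mat n n" "transpose_mat W = W"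
  "\<And>x. x \<in> carrier_vec n \<Longrightarrow> x \<noteq> 0\<^sub>v n \<Longrightarrow> 0 < x \<bullet> (W *\<^sub>v x)"
  using W Wpos by (auto simp: W_def)

lemma start: "d 0 = 0\<^sub>v n" "r 0 = b" "p 0 = z 0"
  using b by (auto simp: d_def r_def p_def z_def)

lemma z_eq: "z k = W *\<^sub>v r k"
  by (cases k) (auto simp: z_def r_def W_def Let_def split: prod.splits)

lemma step:
  "d (Suc k) = d k + \<alpha> k \<cdot>\<^sub>v p k"
  "r (Suc k) = r k - \<alpha> k \<cdot>\<^sub>v (A *\<^sub>v p k)"
  "p (Suc k) = z (Suc k) + \<beta> k \<cdot>\<^sub>v p k"
  by (auto simp: d_def r_def z_def p_def \<alpha>_def \<beta>_def Let_def split: prod.splits)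

lemma carrier: "d k \<in> carrier_vec n \<and> r k \<in> carrier_vec n \<and> p k \<in> carrier_vec n"
proof (induction k)
  case 0
  then show ?case using b start W' z_eq by simp
next
  case (Suc k)
  then show ?case using step[of k] z_eq[of "Suc k"] A W' by simp
qed

lemma carriers [simp]: "d k \<in> carrier_vec n" "r k \<in> carrier_vec n" "p k \<in> carrier_vec n" "z k \<in> carrier_vec n"
  "A *\<^sub>v p k \<in> carrier_vec n"
  using carrier[of k] z_eq[of k] W' A by auto

lemma comm: "x \<in> carrier_vec n \<Longrightarrow> y \<in> carrier_vec n \<Longrightarrow> x \<bullet> y = y \<bullet> (x :: real vec)"
  by (rule comm_scalar_prod)

lemma A_sym: "x \<in> carrier_vec n \<Longrightarrow> y \<in> carrier_vec n \<Longrightarrow> (A *\<^sub>v x) \<bullet> y = x \<bullet> (A *\<^sub>v y)"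
  by (rule sprod_assoc_sym[OF A])

lemma z_r_swap: "z i \<bullet> r j = r i \<bullet> z j"
  using sprod_assoc_sym[OF W'(1,2), of "r i" "r j"] by (simp add: z_eq)

lemma residual: "A *\<^sub>v d k + r k = b"
proof (induction k)
  case 0
  have "A *\<^sub>v 0\<^sub>v n = 0\<^sub>v n" using A by (intro eq_vecI) auto
  then show ?case using b by (simp add: start)
next
  case (Suc k)
  have "A *\<^sub>v d (Suc k) + r (Suc k)
    = A *\<^sub>v d k + \<alpha> k \<cdot>\<^sub>v (A *\<^sub>v p k) + (r k - \<alpha> k \<cdot>\<^sub>v (A *\<^sub>v p k))"
    using A by (simp add: step mult_add_distrib_mat_vec[of _ n n] mult_mat_vec[of _ n n])
  also have "\<dots> = A *\<^sub>v d k + r k"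
    using A by (intro vec_add_sub_cancel[of _ n]) simp_all
  finally show ?case using Suc by simp
qed

lemma rz_pos: "r k \<noteq> 0\<^sub>v n \<Longrightarrow> 0 < r k \<bullet> z k"
  using W'(3)[of "r k"] by (simp add: z_eq)

text \<open>The numerator of \<open>\<alpha>\<close> is 0 from then on, so \<open>\<alpha>\<close> =
  0 even if its denominator vanishes as well (0 / 0 = 0).\<close>

lemma residual_zero_stays: "r k = 0\<^sub>v n \<Longrightarrow> k \<le> j \<Longrightarrow> r j = 0\<^sub>v n"
proof (induction j)
  case (Suc j)
  show ?case
  proof (cases "k = Suc j")
    case False
    then have rj: "r j = 0\<^sub>v n" using Suc by simp
    then have "\<alpha> j = 0" by (simp add: \<alpha>_def)
    then have "r (Suc j) = r j - 0 \<cdot>\<^sub>v (A *\<^sub>v p j)" by (simp add: step)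
    then show ?thesis unfolding smult_zero_vec_eq[OF carriers(5)] rj by simp
  qed (use Suc in simp)
qed simp

text \<open>The relations feed each other and are carried through a single induction. Nonzero
  residuals make every \<open>\<alpha>\<close> positive, so all divisions are genuine; the last
  conjunct says that \<open>\<alpha>\<close> is the exact line-search step.\<close>

lemma orthogonality:
  assumes "\<And>j. j < k \<Longrightarrow> r j \<noteq> 0\<^sub>v n"
  shows "(\<forall>i j. i < j \<and> j \<le> k \<longrightarrow> r j \<bullet> p i = 0 \<and> r j \<bullet> z i = 0 \<and> p j \<bullet> (A *\<^sub>v p i) = 0) \<and>
    (\<forall>j \<le> k. p j \<bullet> r j = r j \<bullet> z j)"
  using assms
proof (induction k)
  case 0
  then show ?case using comm[of "z 0" "r 0"] by (simp add: start(3))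
next
  case (Suc k)
  have IH1: "\<And>i j. i < j \<Longrightarrow> j \<le> k \<Longrightarrow> r j \<bullet> p i = 0 \<and> r j \<bullet> z i = 0 \<and> p j \<bullet> (A *\<^sub>v p i) = 0"
    and IH2: "\<And>j. j \<le> k \<Longrightarrow> p j \<bullet> r j = r j \<bullet> z j"
    using Suc.IH Suc.prems by auto
  have rz: "r j \<bullet> z j > 0" if "j \<le> k" for j using rz_pos Suc.prems that by simp
  have pp: "p j \<bullet> (A *\<^sub>v p j) > 0" if "j \<le> k" for j
  proof -
    have "p j \<noteq> 0\<^sub>v n" using IH2[OF that] rz[OF that] by auto
    then show ?thesis using Apos by simp
  qed
  have \<alpha>: "\<alpha> j > 0" if "j \<le> k" for j using rz[OF that] pp[OF that] by (simp add: \<alpha>_def)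
  have rS: "r (Suc j) \<bullet> y = r j \<bullet> y - \<alpha> j * ((A *\<^sub>v p j) \<bullet> y)" if "y \<in> carrier_vec n" for j y
    using that by (simp add: step minus_scalar_prod_distrib[of _ n] smult_scalar_prod_distrib[of _ n])
  have pS: "p (Suc j) \<bullet> y = z (Suc j) \<bullet> y + \<beta> j * (p j \<bullet> y)" if "y \<in> carrier_vec n" for j y
    using that by (simp add: step add_scalar_prod_distrib[of _ n] smult_scalar_prod_distrib[of _ n])
  \<comment> \<open>For i = k this is the choice of \<open>\<alpha>\<close>, for i < k it follows
    from conjugacy of the directions.\<close>
  have rp: "r (Suc k) \<bullet> p i = 0" if "i \<le> k" for i
  proof (cases "i = k")
    case True
    have "r k \<bullet> p k = r k \<bullet> z k" using IH2[of k] comm[of "p k" "r k"] by simp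
    then show ?thesis using True rS[of "p k" k] A_sym[of "p k" "p k"] pp[of k] by (simp add: \<alpha>_def)
  next
    case False
    then have "i < k" using that by simp
    then show ?thesis using rS[of "p i" k] A_sym[of "p k" "p i"] IH1[of i k] by simp
  qed
  have rz0: "r (Suc k) \<bullet> z i = 0" if "i \<le> k" for i
  proof (cases i)
    case 0
    then show ?thesis using rp[of 0] start by simp
  next
    case (Suc m)
    have "p i \<bullet> r (Suc k) = z i \<bullet> r (Suc k) + \<beta> m * (p m \<bullet> r (Suc k))"
      using pS[of "r (Suc k)" m] Suc by simp
    then show ?thesis using rp[of i] rp[of m] that Suc
      comm[of "p i" "r (Suc k)"] comm[of "p m" "r (Suc k)"] comm[of "z i" "r (Suc k)"] by simp
  qed
  \<comment> \<open>The vector \<open>A *\<^sub>v p i\<close> is traded for the difference of the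
    residuals i and i + 1, divided by \<open>\<alpha> i\<close>. Only i = k leaves a nonzero term,
    and the choice of \<open>\<beta>\<close> cancels it.\<close>
  have pA: "p (Suc k) \<bullet> (A *\<^sub>v p i) = 0" if i: "i \<le> k" for i
  proof -
    have e: "p (Suc k) \<bullet> (A *\<^sub>v p i) = z (Suc k) \<bullet> (A *\<^sub>v p i) + \<beta> k * (p k \<bullet> (A *\<^sub>v p i))"
      by (rule pS) simp
    have "z (Suc k) \<bullet> r (Suc i) = z (Suc k) \<bullet> r i - \<alpha> i * (z (Suc k) \<bullet> (A *\<^sub>v p i))"
      using rS[of "z (Suc k)" i] comm[of "z (Suc k)"] by simp
    then have q: "z (Suc k) \<bullet> (A *\<^sub>v p i) = (z (Suc k) \<bullet> r i - z (Suc k) \<bullet> r (Suc i)) / \<alpha> i"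
      using \<alpha>[OF i] by (simp add: field_simps)
    have zi: "z (Suc k) \<bullet> r i = 0" using rz0[OF i] z_r_swap by simp
    show ?thesis
    proof (cases "i = k")
      case True
      have "z (Suc k) \<bullet> (A *\<^sub>v p k) = - (r (Suc k) \<bullet> z (Suc k)) / \<alpha> k"
        using q zi True comm[of "z (Suc k)" "r (Suc k)"] by simp
      moreover have "\<dots> = - \<beta> k * (p k \<bullet> (A *\<^sub>v p k))"
        using rz[of k] pp[of k] by (simp add: \<alpha>_def \<beta>_def field_simps)
      ultimately show ?thesis using e True by simp
    next
      case False
      then have "i < k" using i by simp
      then have "z (Suc k) \<bullet> r (Suc i) = 0" using rz0[of "Suc i"] z_r_swap by simp
      then show ?thesis using e q zi IH1[of i k] \<open>i < k\<close> by simp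
    qed
  qed
  have "p (Suc k) \<bullet> r (Suc k) = r (Suc k) \<bullet> z (Suc k)"
    using pS[of "r (Suc k)" k] rp[of k] comm[of "p k" "r (Suc k)"] comm[of "z (Suc k)" "r (Suc k)"] by simp
  then show ?case using IH1 IH2 rp rz0 pA by (auto simp: le_Suc_eq less_Suc_eq_le)
qed

text \<open>The span of the first \<open>k\<close> search directions, described as a double orthogonal complement so
  that no coefficients have to be handled.\<close>

definition search_space :: "nat \<Rightarrow> real vec set" where
  "search_space k = {v \<in> carrier_vec n. \<forall>u \<in> carrier_vec n. (\<forall>j<k. u \<bullet> p j = 0) \<longrightarrow> u \<bullet> v = 0}"

lemma search_space_carrier: "v \<in> search_space k \<Longrightarrow> v \<in> carrier_vec n"
  by (simp add: search_space_def)

lemma search_space_dir: "j < k \<Longrightarrow> p j \<in> search_space k"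
  by (simp add: search_space_def)

lemma search_space_mono: "v \<in> search_space k \<Longrightarrow> k \<le> k' \<Longrightarrow> v \<in> search_space k'"
  by (auto simp: search_space_def)

lemma search_space_zero: "0\<^sub>v n \<in> search_space k"
  by (simp add: search_space_def)

lemma search_space_smult: "v \<in> search_space k \<Longrightarrow> c \<cdot>\<^sub>v v \<in> search_space k"
  by (simp add: search_space_def)

lemma search_space_add: "v \<in> search_space k \<Longrightarrow> w \<in> search_space k \<Longrightarrow> v + w \<in> search_space k"
  by (auto simp: search_space_def scalar_prod_add_distrib[of _ n])

lemma search_space_diff: "v \<in> search_space k \<Longrightarrow> w \<in> search_space k \<Longrightarrow> v - w \<in> search_space k"
  by (auto simp: search_space_def scalar_prod_minus_distrib[of _ n])

lemma d_in_search_space: "d k \<in> search_space k"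
proof (induction k)
  case (Suc k)
  then show ?case unfolding step
    by (intro search_space_add search_space_smult search_space_dir search_space_mono[OF Suc]) auto
qed (simp add: start search_space_zero)

lemma z_in_search_space: "j < k \<Longrightarrow> z j \<in> search_space k"
proof (cases j)
  case (Suc i)
  assume "j < k"
  have "z j = p j - \<beta> i \<cdot>\<^sub>v p i"
    unfolding Suc by (rule vec_eq_diff(1)[symmetric, of _ n, OF _ _ step(3)]) simp_all
  then show ?thesis using \<open>j < k\<close> Suc search_space_dir search_space_smult search_space_diff by simp
qed (use search_space_dir[of 0] start in auto)

text \<open>Up to the factor \<open>\<alpha> j\<close> this vector is z j - z (j + 1); the second
  term needs direction j + 1, hence the condition on \<open>Suc j\<close>.\<close>

lemma precond_dir_in_search_space:
  assumes nz: "\<And>j. j < k \<Longrightarrow> r j \<noteq> 0\<^sub>v n" and j: "Suc j < k"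
  shows "W *\<^sub>v (A *\<^sub>v p j) \<in> search_space k"
proof -
  have "r j \<bullet> z j > 0" using rz_pos nz j by simp
  moreover have "p j \<bullet> r j = r j \<bullet> z j"
    using orthogonality[of j] nz j by auto
  ultimately have "p j \<noteq> 0\<^sub>v n" by auto
  then have a: "\<alpha> j \<noteq> 0" using Apos[of "p j"] \<open>r j \<bullet> z j > 0\<close> by (simp add: \<alpha>_def)
  have "z (Suc j) = z j - \<alpha> j \<cdot>\<^sub>v (W *\<^sub>v (A *\<^sub>v p j))"
    unfolding z_eq step using W' by (simp add: mult_minus_distrib_mat_vec[of _ n n] mult_mat_vec[of _ n n])
  then have "W *\<^sub>v (A *\<^sub>v p j) = (1 / \<alpha> j) \<cdot>\<^sub>v (z j - z (Suc j))"
    using a carriers[of j] W' by (auto intro!: eq_vecI)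
  then show ?thesis using j by (auto intro!: search_space_smult search_space_diff z_in_search_space)
qed

text \<open>Passes from directions to their span by duality: if u is orthogonal to the first k + 1
  directions, its image A W u under the adjoint is orthogonal to the first k, and therefore to
  v.\<close>

lemma precond_search_space:
  assumes nz: "\<And>j. j < Suc k \<Longrightarrow> r j \<noteq> 0\<^sub>v n" and v: "v \<in> search_space k"
  shows "W *\<^sub>v (A *\<^sub>v v) \<in> search_space (Suc k)"
  unfolding search_space_def
proof (intro CollectI conjI ballI impI)
  have vc: "v \<in> carrier_vec n" using v by (rule search_space_carrier)
  then show "W *\<^sub>v (A *\<^sub>v v) \<in> carrier_vec n" using W' A by simp
  fix u assume u: "u \<in> carrier_vec n" and orth: "\<forall>j<Suc k. u \<bullet> p j = 0"
  have swap: "u \<bullet> (W *\<^sub>v (A *\<^sub>v x)) = (A *\<^sub>v (W *\<^sub>v u)) \<bullet> x" if "x \<in> carrier_vec n" for x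
    using sprod_assoc_sym[OF W'(1,2) u, of "A *\<^sub>v x"] A_sym[of "W *\<^sub>v u" x] that u W' A by simp
  have "(A *\<^sub>v (W *\<^sub>v u)) \<bullet> p j = 0" if "j < k" for j
  proof -
    have "W *\<^sub>v (A *\<^sub>v p j) \<in> search_space (Suc k)" using precond_dir_in_search_space[OF nz] that by simp
    then have "u \<bullet> (W *\<^sub>v (A *\<^sub>v p j)) = 0" using u orth by (simp add: search_space_def)
    then show ?thesis by (simp add: swap)
  qed
  then have "(A *\<^sub>v (W *\<^sub>v u)) \<bullet> v = 0" using v u A W' by (simp add: search_space_def)
  then show "u \<bullet> (W *\<^sub>v (A *\<^sub>v v)) = 0" by (simp add: swap[OF vc])
qed

text \<open>Pythagoras in the \<open>A\<close>-norm: \<open>A\<close> maps the error x - d k to the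
  residual, which is orthogonal to the search space and so to d k - y.\<close>

lemma optimality:
  assumes x: "x \<in> carrier_vec n" and Ax: "A *\<^sub>v x = b"
    and nz: "\<And>j. j < k \<Longrightarrow> r j \<noteq> 0\<^sub>v n" and y: "y \<in> search_space k"
  shows "(x - d k) \<bullet> (A *\<^sub>v (x - d k)) \<le> (x - y) \<bullet> (A *\<^sub>v (x - y))"
proof -
  let ?e = "x - d k" and ?h = "d k - y"
  have yc: "y \<in> carrier_vec n" using y by (rule search_space_carrier)
  have e: "?e \<in> carrier_vec n" and h: "?h \<in> carrier_vec n" using x yc by auto
  have Ae: "A *\<^sub>v ?e = r k"
    unfolding mult_minus_distrib_mat_vec[OF A(1) x carriers(1)] Ax
    by (rule vec_eq_diff(2)[of _ n, OF _ _ residual[symmetric]]) (use A in simp_all)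
  have "?h \<in> search_space k" using y d_in_search_space search_space_diff by blast
  moreover have "\<forall>j<k. r k \<bullet> p j = 0" using orthogonality[of k] nz by blast
  ultimately have rh: "r k \<bullet> ?h = 0" by (simp add: search_space_def)
  have "x - y = ?e + ?h" by (rule vec_diff_add_diff[OF x carriers(1) yc])
  then have "(x - y) \<bullet> (A *\<^sub>v (x - y)) = ?e \<bullet> (A *\<^sub>v ?e) + ?e \<bullet> (A *\<^sub>v ?h) + (?h \<bullet> (A *\<^sub>v ?e) + ?h \<bullet> (A *\<^sub>v ?h))"
    using A e h by (simp add: mult_add_distrib_mat_vec[OF A(1) e h] add_scalar_prod_distrib[OF e h]
      scalar_prod_add_distrib[of _ n])
  moreover have "?e \<bullet> (A *\<^sub>v ?h) = 0" using A_sym[OF e h] Ae rh by simp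
  moreover have "?h \<bullet> (A *\<^sub>v ?e) = 0" using comm[OF h, of "r k"] Ae rh by simp
  moreover have "0 \<le> ?h \<bullet> (A *\<^sub>v ?h)"
  proof (cases "?h = 0\<^sub>v n")
    case True
    then show ?thesis using A by simp
  qed (use Apos[OF h] in simp)
  ultimately show ?thesis by simp
qed

lemma exact_after_breakdown:
  assumes x: "x \<in> carrier_vec n" and Ax: "A *\<^sub>v x = b" and r: "r k = 0\<^sub>v n"
  shows "d k = x"
proof -
  let ?e = "d k - x"
  have e: "?e \<in> carrier_vec n" using x by simp
  have "A *\<^sub>v d k = b" using residual[of k] r A by simp
  then have "A *\<^sub>v ?e = 0\<^sub>v n"
    using b Ax mult_minus_distrib_mat_vec[OF A(1) carriers(1) x] by simp
  then have "?e = 0\<^sub>v n" using Apos[OF e] e by force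
  then show ?thesis by (rule minus_vec_eq_0D[OF carriers(1) x])
qed

end

section \<open>From polynomial bounds on the spectrum to the rate of PCG\<close>

lemma mult_mat_vec_zero: "A \<in> carrier_mat m n \<Longrightarrow> A *\<^sub>v 0\<^sub>v n = (0\<^sub>v m :: real vec)"
  by (rule eq_vecI) auto

lemma congruence_diag_quadratic:
  fixes A W :: "real mat"
  assumes A: "A \<in> carrier_mat n n" and W: "W \<in> carrier_mat n n"
    and D: "transpose_mat W * A * W = mat_diag n e" and y: "y \<in> carrier_vec n"
  shows "(W *\<^sub>v y) \<bullet> (A *\<^sub>v (W *\<^sub>v y)) = (\<Sum>i<n. e i * (y $ i)\<^sup>2)"
proof -
  have Wt: "transpose_mat W \<in> carrier_mat n n" and AWy: "A *\<^sub>v (W *\<^sub>v y) \<in> carrier_vec n"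
    and Wy: "W *\<^sub>v y \<in> carrier_vec n"
    using A W y by auto
  have "(W *\<^sub>v y) \<bullet> (A *\<^sub>v (W *\<^sub>v y)) = (transpose_mat W *\<^sub>v (A *\<^sub>v (W *\<^sub>v y))) \<bullet> y"
    using transpose_vec_mult_scalar[OF W y AWy] comm_scalar_prod[OF AWy Wy] by simp
  also have "transpose_mat W *\<^sub>v (A *\<^sub>v (W *\<^sub>v y)) = mat_diag n e *\<^sub>v y"
    unfolding D[symmetric] using A W Wt y
    by (simp add: assoc_mult_mat_vec[of _ n n _ n] mult_carrier_mat[of _ n n _ n])
  finally show ?thesis using y
    by (simp add: mat_diag_mult_vec scalar_prod_def atLeast0LessThan power2_eq_square mult_ac)
qed

lemma A_norm_minus_commute:
  assumes A: "A \<in> carrier_mat n n" and u: "u \<in> carrier_vec n" and v: "v \<in> carrier_vec n"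
  shows "A_norm A (u - v) = A_norm A (v - u)"
proof -
  have "u - v = (- 1) \<cdot>\<^sub>v (v - u)" by (rule eq_vecI) (use u v in auto)
  then show ?thesis using A u v by (simp add: A_norm_def mult_mat_vec[of _ n n] scalar_prod_smult_distrib[of _ n] smult_scalar_prod_distrib[of _ n])
qed

context pcg_run
begin

lemma pcg_rate:
  assumes Z: "Z \<in> carrier_mat n n" and ZA: "transpose_mat Z * A * Z = mat_diag n e"
    and ZD: "W * A * Z = Z * mat_diag n e" and e: "\<And>i. i < n \<Longrightarrow> 0 < e i"
    and c: "c \<in> carrier_vec n" and Ax: "A *\<^sub>v (Z *\<^sub>v c) = b"
    and nz: "\<And>j. j < t \<Longrightarrow> r j \<noteq> 0\<^sub>v n"
    and f: "degree f \<le> t" "poly f 0 = 1" "\<And>i. i < n \<Longrightarrow> \<bar>poly f (e i)\<bar> \<le> \<rho>" and \<rho>: "\<rho> \<ge> 0"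
  shows "A_norm A (d t - Z *\<^sub>v c) \<le> \<rho> * A_norm A (Z *\<^sub>v c)"
proof -
  \<comment> \<open>\<open>U g\<close> is g(W A) applied to the exact solution
    \<open>Z *\<^sub>v c\<close>, written in the eigenvector coordinates of W A.\<close>
  define U where "U g = Z *\<^sub>v vec n (\<lambda>i. c $ i * g (e i))" for g
  have Uc: "U g \<in> carrier_vec n" for g using Z by (simp add: U_def)
  have U1: "U (\<lambda>_. 1) = Z *\<^sub>v c" unfolding U_def by (rule arg_cong[where f = "mult_mat_vec Z"]) (use c in auto)
  have U0: "U (\<lambda>_. 0) = 0\<^sub>v n" unfolding U_def by (rule eq_vecI) (use Z in \<open>auto simp: scalar_prod_def\<close>)
  have Uadd: "U (\<lambda>x. a * g x + h x) = a \<cdot>\<^sub>v U g + U h" for a g h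
  proof -
    have "vec n (\<lambda>i. c $ i * (a * g (e i) + h (e i)))
      = a \<cdot>\<^sub>v vec n (\<lambda>i. c $ i * g (e i)) + vec n (\<lambda>i. c $ i * h (e i))"
      by (rule eq_vecI) (auto simp: algebra_simps)
    then show ?thesis using Z unfolding U_def by (simp add: mult_add_distrib_mat_vec[of _ n n] mult_mat_vec[of _ n n])
  qed
  have BU: "W *\<^sub>v (A *\<^sub>v U g) = U (\<lambda>x. x * g x)" for g
  proof -
    let ?y = "vec n (\<lambda>i. c $ i * g (e i))"
    have "W *\<^sub>v (A *\<^sub>v U g) = (W * A * Z) *\<^sub>v ?y"
      using W'(1) A Z by (simp add: U_def assoc_mult_mat_vec[of _ n n _ n] mult_carrier_mat[of _ n n _ n])
    also have "\<dots> = Z *\<^sub>v (mat_diag n e *\<^sub>v ?y)"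
      using Z by (simp add: ZD assoc_mult_mat_vec[of _ n n _ n])
    also have "mat_diag n e *\<^sub>v ?y = vec n (\<lambda>i. c $ i * (e i * g (e i)))"
      by (rule eq_vecI) (auto simp: mat_diag_mult_vec)
    finally show ?thesis by (simp add: U_def)
  qed
  have z0: "z 0 = U (\<lambda>x. x)" using BU[of "\<lambda>_. 1"] Ax by (simp add: U1 z_eq start)
  \<comment> \<open>Horner induction on the coefficients: \<open>z 0\<close> is W A applied to the
    solution, and each further factor x is one application of W A, which costs one more
    direction.\<close>
  have krylov: "U (\<lambda>x. x * poly q x) \<in> search_space (Suc (degree q))"
    if "\<And>j. j < Suc (degree q) \<Longrightarrow> r j \<noteq> 0\<^sub>v n" for q
    using that
  proof (induction q)
    case 0
    then show ?case using U0 search_space_zero by simp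
  next
    case (pCons a q)
    have split: "U (\<lambda>x. x * poly (pCons a q) x) = a \<cdot>\<^sub>v z 0 + U (\<lambda>x. x * (x * poly q x))"
      unfolding z0 Uadd[symmetric] by (simp add: algebra_simps)
    have "z 0 \<in> search_space (Suc (degree (pCons a q)))" by (rule z_in_search_space) simp
    moreover have "U (\<lambda>x. x * (x * poly q x)) \<in> search_space (Suc (degree (pCons a q)))"
    \<comment> \<open>For q = 0 prepending a coefficient does not raise the degree, so the induction
      hypothesis would ask for one direction too many.\<close>
    proof (cases "q = 0")
      case True
      then show ?thesis using U0 search_space_zero by simp
    next
      case False
      then have "U (\<lambda>x. x * poly q x) \<in> search_space (Suc (degree q))" using pCons by simp
      then show ?thesis
        using precond_search_space[of "Suc (degree q)" "U (\<lambda>x. x * poly q x)"] pCons.prems False by (simp add: BU)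
    qed
    ultimately show ?case unfolding split by (intro search_space_add search_space_smult)
  qed
  \<comment> \<open>Writing f = 1 + x q(x) exhibits f(W A) applied to the solution as the error of a
    competitor \<open>y\<close> from the search space.\<close>
  obtain q where q: "f = pCons 1 q" using f(2) by (cases f) auto
  define y where "y = - 1 \<cdot>\<^sub>v U (\<lambda>x. x * poly q x)"
  have y: "y \<in> search_space t"
  proof (cases "q = 0")
    case True
    then show ?thesis using U0 search_space_zero search_space_smult[OF search_space_zero] by (simp add: y_def)
  next
    case False
    then have "Suc (degree q) \<le> t" using f(1) q by simp
    then have "U (\<lambda>x. x * poly q x) \<in> search_space t" using krylov[of q] nz by (auto intro: search_space_mono)
    then show ?thesis unfolding y_def by (rule search_space_smult)
  qed
  have "poly f = (\<lambda>x. 1 * 1 + x * poly q x)" by (simp add: q fun_eq_iff)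
  then have "U (poly f) = 1 \<cdot>\<^sub>v U (\<lambda>_. 1) + U (\<lambda>x. x * poly q x)"
    by (simp only: Uadd)
  also have "\<dots> = Z *\<^sub>v c - y" unfolding U1 y_def
    by (rule eq_vecI) (use Uc[of "\<lambda>x. x * poly q x"] Z in auto)
  finally have Uf: "Z *\<^sub>v c - y = U (poly f)" by simp
  have nrm: "U g \<bullet> (A *\<^sub>v U g) = (\<Sum>i<n. e i * (c $ i * g (e i))\<^sup>2)" for g
    unfolding U_def by (subst congruence_diag_quadratic[OF A(1) Z ZA]) auto
  have Zc: "Z *\<^sub>v c \<in> carrier_vec n" using Z c by simp
  have "(Z *\<^sub>v c - d t) \<bullet> (A *\<^sub>v (Z *\<^sub>v c - d t)) \<le> U (poly f) \<bullet> (A *\<^sub>v U (poly f))"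
    using optimality[OF Zc Ax nz y] unfolding Uf .
  also have "\<dots> \<le> (\<Sum>i<n. \<rho>\<^sup>2 * (e i * (c $ i * 1)\<^sup>2))" unfolding nrm
  proof (rule sum_mono)
    fix i assume "i \<in> {..<n}"
    then have i: "i < n" by simp
    have "(poly f (e i))\<^sup>2 \<le> \<rho>\<^sup>2" using f(3)[OF i] \<rho> by (simp add: abs_le_square_iff[symmetric])
    then have "e i * (c $ i)\<^sup>2 * (poly f (e i))\<^sup>2 \<le> e i * (c $ i)\<^sup>2 * \<rho>\<^sup>2"
      using e[OF i] by (intro mult_left_mono) auto
    then show "e i * (c $ i * poly f (e i))\<^sup>2 \<le> \<rho>\<^sup>2 * (e i * (c $ i * 1)\<^sup>2)"
      by (simp add: power_mult_distrib mult_ac)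
  qed
  also have "\<dots> = \<rho>\<^sup>2 * ((Z *\<^sub>v c) \<bullet> (A *\<^sub>v (Z *\<^sub>v c)))"
    unfolding U1[symmetric] nrm by (simp add: sum_distrib_left)
  finally have "A_norm A (Z *\<^sub>v c - d t) \<le> sqrt (\<rho>\<^sup>2 * ((Z *\<^sub>v c) \<bullet> (A *\<^sub>v (Z *\<^sub>v c))))"
    unfolding A_norm_def by (rule real_sqrt_le_mono)
  then show ?thesis using A_norm_minus_commute[OF A(1) carriers(1) Zc] \<rho> by (simp add: A_norm_def real_sqrt_mult)
qed

end

theorem pcg_convergence:
  fixes A P :: "real mat"
  assumes A: "A \<in> carrier_mat n n" "transpose_mat A = A"
    and P: "P \<in> carrier_mat n n" "transpose_mat P = P"
    and pos: "\<And>x. x \<in> carrier_vec n \<Longrightarrow> x \<noteq> 0\<^sub>v n \<Longrightarrow> 0 < x \<bullet> (P *\<^sub>v x)"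
    and lower: "\<And>x. x \<in> carrier_vec n \<Longrightarrow> x \<bullet> (P *\<^sub>v x) \<le> x \<bullet> (A *\<^sub>v x)"
    and upper: "\<And>x. x \<in> carrier_vec n \<Longrightarrow> x \<bullet> (A *\<^sub>v x) \<le> \<kappa> * (x \<bullet> (P *\<^sub>v x))"
    and \<kappa>: "1 < \<kappa>" and b: "b \<in> carrier_vec n"
  shows "A_norm A (pcg A P b t - mat_inv A *\<^sub>v b)
    \<le> 2 * ((sqrt \<kappa> - 1) / (sqrt \<kappa> + 1)) ^ t * A_norm A (mat_inv A *\<^sub>v b)"
proof -
  have Apos: "0 < x \<bullet> (A *\<^sub>v x)" if "x \<in> carrier_vec n" "x \<noteq> 0\<^sub>v n" for x
    using pos[OF that] lower[OF that(1)] by simp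
  note invA = inverse_sqrt[OF A Apos]
  note invP = inverse_sqrt[OF P pos]
  define S where "S = mat_inv (mat_sqrt P)"
  have S: "S \<in> carrier_mat n n" "transpose_mat S = S" "mat_inv P = S * S" "S * P * S = 1\<^sub>m n"
    unfolding S_def using invP by auto
  have Wc: "mat_inv P \<in> carrier_mat n n" using S by simp
  have Wsym: "transpose_mat (mat_inv P) = mat_inv P"
    using S transpose_mult[OF S(1) S(1)] by simp
  have Wpos: "0 < x \<bullet> (mat_inv P *\<^sub>v x)" if x: "x \<in> carrier_vec n" "x \<noteq> 0\<^sub>v n" for x
  proof -
    have Sx: "S *\<^sub>v x \<in> carrier_vec n" using S x by simp
    have "x \<bullet> (mat_inv P *\<^sub>v x) = (S *\<^sub>v x) \<bullet> (S *\<^sub>v x)"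
      using sprod_assoc_sym[OF S(1,2) x(1) Sx] S(1) x by (simp add: S(3) assoc_mult_mat_vec[of _ n n _ n])
    moreover have "S *\<^sub>v x \<noteq> 0\<^sub>v n"
    proof
      assume "S *\<^sub>v x = 0\<^sub>v n"
      then have "P *\<^sub>v (mat_inv P *\<^sub>v x) = P *\<^sub>v (S *\<^sub>v 0\<^sub>v n)"
        using S(1) x by (simp add: S(3) assoc_mult_mat_vec[of _ n n _ n])
      also have "\<dots> = 0\<^sub>v n" using P(1) S(1) by (simp add: mult_mat_vec_zero)
      finally have "(P * mat_inv P) *\<^sub>v x = 0\<^sub>v n" using P Wc x by (simp add: assoc_mult_mat_vec[of _ n n _ n])
      then show False using invP(6) x by simp
    qed
    ultimately show ?thesis using sprod_self_pos[OF Sx] by simp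
  qed
  interpret pcg_run n A P "mat_inv P" b
    by unfold_locales (use A Apos Wc Wsym Wpos b in auto)
  let ?x = "mat_inv A *\<^sub>v b"
  have Ac: "mat_inv A \<in> carrier_mat n n" using invA(1,4) by simp
  then have x: "?x \<in> carrier_vec n" using b by simp
  have Ax: "A *\<^sub>v ?x = b" using invA(6) Ac A b by (simp add: assoc_mult_mat_vec[of _ n n _ n, symmetric])
  have pd: "pcg A P b t = d t" by (simp add: pcg_def d_def)
  let ?\<rho> = "2 * ((sqrt \<kappa> - 1) / (sqrt \<kappa> + 1)) ^ t"
  have \<rho>: "?\<rho> \<ge> 0" using \<kappa> by simp
  show ?thesis
  \<comment> \<open>After a breakdown the iterate is exact; otherwise all residuals before step t
    are nonzero, as the orthogonality relations require.\<close>
  proof (cases "\<exists>j<t. r j = 0\<^sub>v n")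
    case True
    then have "r t = 0\<^sub>v n" using residual_zero_stays by (metis less_imp_le)
    then have "d t = ?x" by (rule exact_after_breakdown[OF x Ax])
    then have "A_norm A (pcg A P b t - ?x) = 0" using A x by (simp add: pd A_norm_def)
    moreover have "0 \<le> A_norm A ?x"
    proof (cases "?x = 0\<^sub>v n")
      case True
      then show ?thesis using A by (simp add: A_norm_def)
    qed (use Apos[OF x] in \<open>simp add: A_norm_def\<close>)
    ultimately show ?thesis using \<rho> by simp
  next
    case False
    define M where "M = S * A * S"
    note spec = preconditioned_spectrum[OF A P pos lower upper, folded S_def, folded M_def]
    obtain Z X where Z: "Z \<in> carrier_mat n n" "transpose_mat Z * A * Z = mat_diag n (\<lambda>i. eigs M ! i)"
      "mat_inv P * A * Z = Z * mat_diag n (\<lambda>i. eigs M ! i)" and X: "X \<in> carrier_mat n n" "Z * X = 1\<^sub>m n"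
      using spec(3) by auto
    have sp: "1 \<le> eigs M ! i \<and> eigs M ! i \<le> \<kappa>" if "i < n" for i using spec(2) that by simp
    \<comment> \<open>Coordinates of the solution in the generalized eigenvectors, available because
      \<open>Z\<close> has the right inverse \<open>X\<close>.\<close>
    define c where "c = X *\<^sub>v ?x"
    have c: "c \<in> carrier_vec n" using X x by (simp add: c_def)
    have Zc: "Z *\<^sub>v c = ?x" using Z X x by (simp add: c_def assoc_mult_mat_vec[of _ n n _ n, symmetric])
    obtain f :: "real poly" where f: "degree f \<le> t" "poly f 0 = 1"
      "\<And>x. 1 \<le> x \<Longrightarrow> x \<le> \<kappa> \<Longrightarrow> \<bar>poly f x\<bar> \<le> ?\<rho>"
      using shifted_cheb_bound[OF \<kappa>, of t] by blast
    have "A_norm A (d t - Z *\<^sub>v c) \<le> ?\<rho> * A_norm A (Z *\<^sub>v c)"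
    proof (rule pcg_rate[OF Z(1,2,3) _ c _ _ f(1,2) _ \<rho>])
      show "A *\<^sub>v (Z *\<^sub>v c) = b" using Zc Ax by simp
      show "r j \<noteq> 0\<^sub>v n" if "j < t" for j using False that by blast
      show "0 < eigs M ! i" if "i < n" for i using sp[OF that] by simp
      show "\<bar>poly f (eigs M ! i)\<bar> \<le> ?\<rho>" if "i < n" for i using f(3) sp[OF that] by blast
    qed
    then show ?thesis by (simp add: Zc pd)
  qed
qed

section \<open>Randomly pivoted Cholesky\<close>

lemma sym_psdD:
  assumes "sym_psd n R"
  shows "R \<in> carrier_mat n n" "transpose_mat R = R" "\<And>x. x \<in> carrier_vec n \<Longrightarrow> 0 \<le> x \<bullet> (R *\<^sub>v x)"
  using assms by (auto simp: sym_psd_def)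

lemma psd_cauchy_schwarz:
  assumes R: "sym_psd n R" and x: "x \<in> carrier_vec n" and y: "y \<in> carrier_vec n"
  shows "(x \<bullet> (R *\<^sub>v y))\<^sup>2 \<le> (x \<bullet> (R *\<^sub>v x)) * (y \<bullet> (R *\<^sub>v y))"
proof -
  note R = sym_psdD[OF R]
  let ?a = "x \<bullet> (R *\<^sub>v x)" and ?b = "x \<bullet> (R *\<^sub>v y)" and ?c = "y \<bullet> (R *\<^sub>v y)"
  have Rx: "R *\<^sub>v x \<in> carrier_vec n" and Ry: "R *\<^sub>v y \<in> carrier_vec n" using R x y by auto
  have yx: "y \<bullet> (R *\<^sub>v x) = ?b"
    using sprod_assoc_sym[OF R(1,2) y x] comm_scalar_prod[OF Ry x] by simp
  have nonneg: "0 \<le> ?a + 2 * t * ?b + t * t * ?c" for t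
  proof -
    have ty: "t \<cdot>\<^sub>v y \<in> carrier_vec n" using y by simp
    have "(x + t \<cdot>\<^sub>v y) \<bullet> (R *\<^sub>v (x + t \<cdot>\<^sub>v y)) = ?a + t * ?b + (t * ?b + t * (t * ?c))"
      using R(1) x y Rx Ry
      by (simp add: mult_add_distrib_mat_vec[OF R(1) x ty] mult_mat_vec[of _ n n] add_scalar_prod_distrib[OF x ty]
        scalar_prod_add_distrib[of _ n] smult_scalar_prod_distrib[of _ n] scalar_prod_smult_distrib[of _ n] yx algebra_simps)
    then show ?thesis using R(3)[of "x + t \<cdot>\<^sub>v y"] x y by (simp add: algebra_simps)
  qed
  show ?thesis
  proof (cases "?c = 0")
    case True
    have "?b = 0"
    proof (rule ccontr)
      assume b0: "?b \<noteq> 0"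
      \<comment> \<open>With c = 0 the form is affine in t, and this t gives it the value
        -1.\<close>
      then show False using nonneg[of "- (?a + 1) / (2 * ?b)"] True by (simp add: field_simps)
    qed
    then show ?thesis using True by simp
  next
    case False
    then have c: "?c > 0" using R(3)[OF y] by simp
    have "?a + 2 * (- ?b / ?c) * ?b + (- ?b / ?c) * (- ?b / ?c) * ?c = ?a - ?b\<^sup>2 / ?c"
      using c by (simp add: field_simps power2_eq_square)
    then have "?b\<^sup>2 / ?c \<le> ?a" using nonneg[of "- ?b / ?c"] by simp
    then show ?thesis using c by (simp add: field_simps)
  qed
qed

lemma sym_psd_one: "sym_psd n (1\<^sub>m n)"
  by (auto simp: sym_psd_def sprod_self_nonneg)

lemma sprod_cauchy_schwarz:
  fixes x y :: "real vec"
  assumes "x \<in> carrier_vec n" "y \<in> carrier_vec n"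
  shows "(x \<bullet> y)\<^sup>2 \<le> (x \<bullet> x) * (y \<bullet> y)"
  using psd_cauchy_schwarz[OF sym_psd_one assms] assms by simp

lemma mult_unit_vec: "R \<in> carrier_mat n n \<Longrightarrow> i < n \<Longrightarrow> R *\<^sub>v unit_vec n i = (col R i :: real vec)"
  by (rule eq_vecI) auto

lemma sym_mult_vec_index:
  assumes "R \<in> carrier_mat n n" "transpose_mat R = R" "i < n"
  shows "(R *\<^sub>v x) $ i = col R i \<bullet> (x :: real vec)"
  using assms col_transpose[of i R] by simp

lemma psd_diag_nonneg:
  assumes R: "sym_psd n R" and i: "i < n"
  shows "0 \<le> R $$ (i, i)"
  using sym_psdD(3)[OF R, of "unit_vec n i"] sym_psdD(1)[OF R] i by (simp add: mult_unit_vec)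

text \<open>Cauchy-Schwarz against a unit vector. It makes an elimination step preserve
  semidefiniteness, and it forces the column of a zero diagonal entry to vanish.\<close>

lemma psd_col_bound:
  assumes R: "sym_psd n R" and i: "i < n" and x: "x \<in> carrier_vec n"
  shows "(col R i \<bullet> x)\<^sup>2 \<le> R $$ (i, i) * (x \<bullet> (R *\<^sub>v x))"
proof -
  have "unit_vec n i \<bullet> (R *\<^sub>v x) = col R i \<bullet> x"
    using sym_mult_vec_index[OF sym_psdD(1,2)[OF R] i, of x] sym_psdD(1)[OF R] i x by simp
  moreover have "unit_vec n i \<bullet> (R *\<^sub>v unit_vec n i) = R $$ (i, i)"
    using sym_psdD(1)[OF R] i by (simp add: mult_unit_vec)
  ultimately show ?thesis using psd_cauchy_schwarz[OF R, of "unit_vec n i" x] x by simp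
qed

lemma mtrace_nonneg: "sym_psd n R \<Longrightarrow> 0 \<le> mtrace R"
  unfolding mtrace_def using sym_psdD(1)[of n R] by (intro sum_nonneg) (auto intro: psd_diag_nonneg)

lemma sym_sq_norm:
  assumes R: "R \<in> carrier_mat n n" "transpose_mat R = R"
  shows "(R *\<^sub>v x) \<bullet> (R *\<^sub>v x) = (\<Sum>i<n. (col R i \<bullet> (x :: real vec))\<^sup>2)"
proof -
  have "(R *\<^sub>v x) \<bullet> (R *\<^sub>v x) = (\<Sum>i<n. (R *\<^sub>v x) $ i * (R *\<^sub>v x) $ i)"
    using R by (simp add: scalar_prod_def atLeast0LessThan)
  also have "\<dots> = (\<Sum>i<n. (col R i \<bullet> x)\<^sup>2)"
    by (rule sum.cong) (simp_all add: sym_mult_vec_index[OF R] power2_eq_square del: index_mult_mat_vec)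
  finally show ?thesis .
qed

text \<open>Summing \<open>psd_col_bound\<close> over the columns bounds |R x|^2 by tr R times q = x
  . R x; together with q^2 \<le> |x|^2 |R x|^2 one factor q cancels.\<close>

lemma psd_le_trace:
  assumes R: "sym_psd n R" and x: "x \<in> carrier_vec n"
  shows "x \<bullet> (R *\<^sub>v x) \<le> mtrace R * (x \<bullet> x)"
proof -
  let ?q = "x \<bullet> (R *\<^sub>v x)"
  have Rx: "R *\<^sub>v x \<in> carrier_vec n" using sym_psdD(1)[OF R] x by simp
  have "(R *\<^sub>v x) \<bullet> (R *\<^sub>v x) \<le> (\<Sum>i<n. R $$ (i, i) * ?q)"
    unfolding sym_sq_norm[OF sym_psdD(1,2)[OF R]] by (rule sum_mono) (simp add: psd_col_bound[OF R _ x])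
  also have "\<dots> = mtrace R * ?q" using sym_psdD(1)[OF R] by (simp add: mtrace_def sum_distrib_right)
  finally have "(x \<bullet> x) * ((R *\<^sub>v x) \<bullet> (R *\<^sub>v x)) \<le> (x \<bullet> x) * (mtrace R * ?q)"
    by (intro mult_left_mono sprod_self_nonneg)
  then have "?q * ?q \<le> (mtrace R * (x \<bullet> x)) * ?q"
    using sprod_cauchy_schwarz[OF x Rx] by (simp add: power2_eq_square mult_ac)
  then show ?thesis
    using sym_psdD(3)[OF R x] mtrace_nonneg[OF R] sprod_self_nonneg[of x]
    by (metis mult_le_cancel_right_pos mult_nonneg_nonneg order_le_less)
qed

lemma mtrace_comm:
  assumes "A \<in> carrier_mat n m" "B \<in> carrier_mat m n"
  shows "mtrace (A * B) = mtrace (B * A)"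
proof -
  have "mtrace (A * B) = (\<Sum>i<n. \<Sum>j<m. A $$ (i, j) * B $$ (j, i))"
    using assms by (simp add: mtrace_def scalar_prod_def atLeast0LessThan)
  also have "\<dots> = (\<Sum>j<m. \<Sum>i<n. B $$ (j, i) * A $$ (i, j))"
    by (subst sum.swap) (simp add: mult.commute)
  also have "\<dots> = mtrace (B * A)"
    using assms by (simp add: mtrace_def scalar_prod_def atLeast0LessThan)
  finally show ?thesis .
qed

lemma mtrace_orthonormal:
  assumes R: "R \<in> carrier_mat n n" and V: "V \<in> carrier_mat n n" and VVt: "V * transpose_mat V = 1\<^sub>m n"
  shows "(\<Sum>i<n. col V i \<bullet> (R *\<^sub>v col V i)) = mtrace R"
proof -
  have Vt: "transpose_mat V \<in> carrier_mat n n" using V by simp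
  have "(\<Sum>i<n. col V i \<bullet> (R *\<^sub>v col V i)) = mtrace (transpose_mat V * R * V)"
    using R V Vt congruence_entry[OF R V] by (simp add: mtrace_def)
  also have "\<dots> = mtrace (V * (transpose_mat V * R))"
    by (rule mtrace_comm) (use V Vt R in auto)
  also have "V * (transpose_mat V * R) = (V * transpose_mat V) * R"
    using V Vt R by (simp add: assoc_mult_mat[of _ n n _ n _ n])
  finally show ?thesis using VVt R by simp
qed

section \<open>One elimination step as a Schur complement\<close>

lemma outer_carrier [simp]: "outer n g \<in> carrier_mat n n"
  by (simp add: outer_def)

lemma outer_mult_vec:
  assumes "g \<in> carrier_vec n" "x \<in> carrier_vec n"
  shows "outer n g *\<^sub>v x = (g \<bullet> x) \<cdot>\<^sub>v g"
  by (rule eq_vecI) (use assms in \<open>auto simp: outer_def scalar_prod_def sum_distrib_left mult_ac\<close>)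

lemma outer_quadratic:
  assumes "g \<in> carrier_vec n" "x \<in> carrier_vec n"
  shows "x \<bullet> (outer n g *\<^sub>v x) = (g \<bullet> x)\<^sup>2"
  using assms comm_scalar_prod[of x n g]
  by (simp add: outer_mult_vec scalar_prod_smult_distrib[of _ n] power2_eq_square)

lemma outer_transpose: "transpose_mat (outer n g) = outer n g"
  by (rule eq_matI) (auto simp: outer_def mult.commute)

definition pivot_col :: "real mat \<Rightarrow> nat \<Rightarrow> real Matrix.vec" where
  "pivot_col R s = (1 / sqrt (R $$ (s, s))) \<cdot>\<^sub>v col R s"

definition chol_step :: "nat \<Rightarrow> real mat \<Rightarrow> nat \<Rightarrow> real mat" where
  "chol_step n R s = R - outer n (pivot_col R s)"

lemma pivot_col_carrier: "R \<in> carrier_mat n n \<Longrightarrow> pivot_col R s \<in> carrier_vec n"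
  by (auto simp: pivot_col_def)

text \<open>If \<open>R\<^sub>s\<^sub>s = 0\<close> then, because of \<open>1 / 0 = 0\<close>, the step leaves \<open>R\<close> unchanged and the formula still
  holds.\<close>

lemma chol_step_quadratic:
  assumes R: "sym_psd n R" and s: "s < n" and x: "x \<in> carrier_vec n"
  shows "x \<bullet> (chol_step n R s *\<^sub>v x) = x \<bullet> (R *\<^sub>v x) - (col R s \<bullet> x)\<^sup>2 / R $$ (s, s)"
proof -
  note Rc = sym_psdD(1)[OF R]
  have g: "pivot_col R s \<in> carrier_vec n" by (rule pivot_col_carrier[OF Rc])
  have c: "col R s \<in> carrier_vec n" using Rc s by auto
  have "x \<bullet> (chol_step n R s *\<^sub>v x) = x \<bullet> (R *\<^sub>v x) - (pivot_col R s \<bullet> x)\<^sup>2"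
    using Rc x g outer_quadratic[OF g x]
    by (simp add: chol_step_def minus_mult_distrib_mat_vec[of _ n n] scalar_prod_minus_distrib[of _ n] mult_mat_vec_carrier[of _ n n])
  then show ?thesis using psd_diag_nonneg[OF R s] smult_scalar_prod_distrib[OF c x]
    by (simp add: pivot_col_def power_mult_distrib power_divide)
qed

lemma chol_step_psd:
  assumes R: "sym_psd n R" and s: "s < n"
  shows "sym_psd n (chol_step n R s)"
  unfolding sym_psd_def
proof (intro conjI ballI)
  note Rc = sym_psdD(1,2)[OF R]
  show "chol_step n R s \<in> carrier_mat n n" by (simp add: chol_step_def minus_carrier_mat)
  show "transpose_mat (chol_step n R s) = chol_step n R s"
    using transpose_minus[OF Rc(1) outer_carrier] Rc by (simp add: chol_step_def outer_transpose)
  fix x :: "real vec" assume x: "x \<in> carrier_vec n"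
  have "(col R s \<bullet> x)\<^sup>2 / R $$ (s, s) \<le> x \<bullet> (R *\<^sub>v x)"
    using psd_col_bound[OF R s x] psd_diag_nonneg[OF R s] sym_psdD(3)[OF R x]
    by (cases "R $$ (s, s) = 0") (auto simp: field_simps)
  then show "0 \<le> x \<bullet> (chol_step n R s *\<^sub>v x)" by (simp add: chol_step_quadratic[OF R s x])
qed

lemma gram_cols_carrier [simp]: "gram_cols n F \<in> carrier_mat n n"
  by (simp add: gram_cols_def)

lemma gram_cols_Cons: "gram_cols n (g # F) = outer n g + gram_cols n F"
  by (rule eq_matI) (auto simp: gram_cols_def outer_def)

lemma gram_cols_zero: "gram_cols n (replicate k (0\<^sub>v n)) = 0\<^sub>m n n"
  by (rule eq_matI) (auto simp: gram_cols_def sum_list_replicate)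

lemma gram_cols_transpose: "transpose_mat (gram_cols n F) = gram_cols n F"
  by (rule eq_matI) (auto simp: gram_cols_def mult.commute)

lemma gram_cols_psd: "set F \<subseteq> carrier_vec n \<Longrightarrow> sym_psd n (gram_cols n F)"
proof (induction F)
  case Nil
  have "gram_cols n [] = 0\<^sub>m n n" using gram_cols_zero[of n 0] by simp
  moreover have "0\<^sub>m n n *\<^sub>v x = 0\<^sub>v n" if "x \<in> carrier_vec n" for x :: "real vec"
    by (rule eq_vecI) (use that in \<open>auto simp: scalar_prod_def\<close>)
  ultimately show ?case by (auto simp: sym_psd_def)
next
  case (Cons g F)
  then have F: "sym_psd n (gram_cols n F)" and g: "g \<in> carrier_vec n" by auto
  show ?case unfolding sym_psd_def
  proof (intro conjI ballI)
    fix x :: "real vec" assume x: "x \<in> carrier_vec n"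
    have "x \<bullet> (gram_cols n (g # F) *\<^sub>v x) = (g \<bullet> x)\<^sup>2 + x \<bullet> (gram_cols n F *\<^sub>v x)"
      using x outer_quadratic[OF g x]
      by (simp add: gram_cols_Cons add_mult_distrib_mat_vec[of _ n n] scalar_prod_add_distrib[of _ n] mult_mat_vec_carrier[of _ n n])
    then show "0 \<le> x \<bullet> (gram_cols n (g # F) *\<^sub>v x)" using sym_psdD(3)[OF F x] by simp
  qed (simp_all add: gram_cols_transpose)
qed

text \<open>Lets inductions follow the recursion of \<open>rpc\<close>: the final residual of
  \<open>R\<close> is the final residual of the matrix after its first step.\<close>

lemma residual_Cons:
  assumes "R \<in> carrier_mat n n"
  shows "R - gram_cols n (pivot_col R s # F) = chol_step n R s - gram_cols n F"
  unfolding gram_cols_Cons chol_step_def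
  by (rule eq_matI) (use assms in \<open>auto simp: gram_cols_def outer_def\<close>)

section \<open>Pivot distribution and support of the output\<close>

definition pivot_pmf :: "nat \<Rightarrow> real mat \<Rightarrow> nat pmf" where
  "pivot_pmf n R = embed_pmf (\<lambda>j. if j < n then R $$ (j, j) / mtrace R else 0)"

lemma pivot_pmf:
  assumes R: "sym_psd n R" and tr: "mtrace R > 0"
  shows "pmf (pivot_pmf n R) j = (if j < n then R $$ (j, j) / mtrace R else 0)"
  unfolding pivot_pmf_def
proof (rule pmf_embed_pmf)
  let ?f = "\<lambda>j. if j < n then R $$ (j, j) / mtrace R else 0"
  show nn: "0 \<le> ?f j" for j using psd_diag_nonneg[OF R] tr by simp
  have "(\<integral>\<^sup>+ j. ennreal (?f j) \<partial>count_space UNIV) = (\<integral>\<^sup>+ j. ennreal (?f j) \<partial>count_space {..<n})"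
    by (rule nn_integral_count_space_eq) auto
  also have "\<dots> = (\<Sum>j<n. ennreal (?f j))" by (rule nn_integral_count_space_finite) simp
  also have "\<dots> = ennreal (\<Sum>j<n. ?f j)" by (rule sum_ennreal) (rule nn)
  also have "(\<Sum>j<n. ?f j) = mtrace R / mtrace R"
    using sym_psdD(1)[OF R] by (simp add: mtrace_def sum_divide_distrib[symmetric])
  finally show "(\<integral>\<^sup>+ j. ennreal (?f j) \<partial>count_space UNIV) = 1" using tr by simp
qed

lemma set_pivot_pmf:
  assumes "sym_psd n R" "mtrace R > 0"
  shows "set_pmf (pivot_pmf n R) = {j. j < n \<and> R $$ (j, j) > 0}"
  using pivot_pmf[OF assms] psd_diag_nonneg[OF assms(1)] assms(2)
  by (auto simp: set_pmf_eq zero_less_divide_iff dual_order.order_iff_strict split: if_splits)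

lemma rpc_Suc:
  "mtrace R > 0 \<Longrightarrow> rpc n R (Suc k) = pivot_pmf n R \<bind> (\<lambda>s. map_pmf ((#) (pivot_col R s)) (rpc n (chol_step n R s) k))"
  by (simp add: pivot_pmf_def pivot_col_def chol_step_def Let_def)

lemma rpc_degenerate: "mtrace R \<le> 0 \<Longrightarrow> rpc n R k = return_pmf (replicate k (0\<^sub>v n))"
  by (cases k) auto

lemma minus_zero_gram: "R \<in> carrier_mat n n \<Longrightarrow> R - gram_cols n (replicate k (0\<^sub>v n)) = R"
  unfolding gram_cols_zero by (rule eq_matI) auto

lemma rpc_support_cases:
  assumes R: "sym_psd n R" and F: "F \<in> set_pmf (rpc n R (Suc k))" and tr: "mtrace R > 0"
  obtains s F' where "s < n" "R $$ (s, s) > 0" "F = pivot_col R s # F'" "F' \<in> set_pmf (rpc n (chol_step n R s) k)"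
  using F unfolding rpc_Suc[OF tr] by (auto simp: set_pivot_pmf[OF R tr])

text \<open>Finite support makes every real function of the output integrable.\<close>

lemma finite_rpc: "sym_psd n R \<Longrightarrow> finite (set_pmf (rpc n R k))"
proof (induction k arbitrary: R)
  case (Suc k)
  show ?case
  proof (cases "mtrace R > 0")
    case True
    then show ?thesis unfolding rpc_Suc[OF True] using Suc.IH[OF chol_step_psd[OF Suc.prems]] Suc.prems
      by (auto simp: set_pivot_pmf)
  qed (simp add: rpc_degenerate)
qed simp

lemma rpc_residual_psd:
  "sym_psd n R \<Longrightarrow> F \<in> set_pmf (rpc n R k) \<Longrightarrow> set F \<subseteq> carrier_vec n \<and> sym_psd n (R - gram_cols n F)"
proof (induction k arbitrary: R F)
  case 0
  then show ?case using minus_zero_gram[OF sym_psdD(1)[OF 0(1)], of 0] by simp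
next
  case (Suc k)
  note Rc = sym_psdD(1)[OF Suc.prems(1)]
  show ?case
  proof (cases "mtrace R > 0")
    case True
    obtain s F' where s: "s < n" and F: "F = pivot_col R s # F'" and F': "F' \<in> set_pmf (rpc n (chol_step n R s) k)"
      using rpc_support_cases[OF Suc.prems True] by metis
    show ?thesis using Suc.IH[OF chol_step_psd[OF Suc.prems(1) s] F'] pivot_col_carrier[OF Rc]
      unfolding F residual_Cons[OF Rc] by auto
  next
    case False
    then have "F = replicate (Suc k) (0\<^sub>v n)" using Suc.prems(2) by (simp add: rpc_degenerate)
    then show ?thesis using minus_zero_gram[OF Rc, of "Suc k"] Suc.prems(1) by auto
  qed
qed

text \<open>Every step zeroes the diagonal entry of its pivot and creates no new nonzero diagonal entry.\<close>

lemma rpc_exact: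
  "sym_psd n R \<Longrightarrow> card {j. j < n \<and> R $$ (j, j) \<noteq> 0} \<le> k \<Longrightarrow> F \<in> set_pmf (rpc n R k) \<Longrightarrow>
    mtrace (R - gram_cols n F) = 0"
proof (induction k arbitrary: R F)
  case 0
  then have "{j. j < n \<and> R $$ (j, j) \<noteq> 0} = {}" by simp
  then have "mtrace R = 0" using sym_psdD(1)[OF 0(1)] by (auto simp: mtrace_def)
  then show ?case using 0 minus_zero_gram[OF sym_psdD(1)[OF 0(1)], of 0] by simp
next
  case (Suc k)
  note R = Suc.prems(1) and Rc = sym_psdD(1)[OF Suc.prems(1)]
  show ?case
  proof (cases "mtrace R > 0")
    case True
    obtain s F' where s: "s < n" "R $$ (s, s) > 0" and F: "F = pivot_col R s # F'"
      and F': "F' \<in> set_pmf (rpc n (chol_step n R s) k)"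
      using rpc_support_cases[OF R Suc.prems(3) True] by metis
    note R' = chol_step_psd[OF R s(1)]
    have diag: "chol_step n R s $$ (j, j) = R $$ (j, j) - (R $$ (j, s))\<^sup>2 / R $$ (s, s)" if j: "j < n" for j
      using chol_step_quadratic[OF R s(1), of "unit_vec n j"] Rc sym_psdD(1)[OF R'] j s(1) by (simp add: mult_unit_vec)
    have ss: "chol_step n R s $$ (s, s) = 0" using diag[OF s(1)] s by (simp add: power2_eq_square)
    \<comment> \<open>Diagonal entries only decrease and remain nonnegative, so a zero stays
      zero.\<close>
    have keep: "chol_step n R s $$ (j, j) = 0" if "j < n" "R $$ (j, j) = 0" for j
    proof -
      have "0 \<le> (R $$ (j, s))\<^sup>2 / R $$ (s, s)" using s(2) by simp
      then show ?thesis using diag[OF that(1)] that(2) psd_diag_nonneg[OF R' that(1)] by simp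
    qed
    have "{j. j < n \<and> chol_step n R s $$ (j, j) \<noteq> 0} \<subseteq> {j. j < n \<and> R $$ (j, j) \<noteq> 0} - {s}"
      using ss keep by auto
    then have "card {j. j < n \<and> chol_step n R s $$ (j, j) \<noteq> 0} \<le> card ({j. j < n \<and> R $$ (j, j) \<noteq> 0} - {s})"
      by (intro card_mono) auto
    also have "\<dots> \<le> k" using Suc.prems(2) s by (subst card_Diff_singleton) auto
    finally show ?thesis unfolding F residual_Cons[OF Rc] by (rule Suc.IH[OF R' _ F'])
  next
    case False
    then have "mtrace R = 0" using mtrace_nonneg[OF R] by simp
    moreover have "F = replicate (Suc k) (0\<^sub>v n)" using False Suc.prems(3) by (simp add: rpc_degenerate)
    ultimately show ?thesis using minus_zero_gram[OF Rc, of "Suc k"] by simp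
  qed
qed

section \<open>Decay of the expected residual\<close>

definition chol_map :: "real \<Rightarrow> real \<Rightarrow> real \<Rightarrow> real" where
  "chol_map l b x = x - x\<^sup>2 / (l * (x + b))"

context
  fixes l b :: real
  assumes l: "1 \<le> l" and b: "0 < b"
begin

text \<open>An affine function of nonnegative slope (as l \<ge> 1) minus a multiple of 1 / (x + b):
  monotonicity and concavity can be read off.\<close>

lemma chol_map_alt:
  assumes "0 \<le> x"
  shows "chol_map l b x = (1 - 1 / l) * x + b / l - b\<^sup>2 / l * inverse (x + b)"
proof -
  have "x\<^sup>2 / (x + b) = x - b + b\<^sup>2 * inverse (x + b)"
    using assms b by (simp add: field_simps power2_eq_square)
  then have "x\<^sup>2 / (l * (x + b)) = (x - b + b\<^sup>2 * inverse (x + b)) / l"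
    by (metis divide_divide_eq_left mult.commute)
  then show ?thesis by (simp add: chol_map_def algebra_simps add_divide_distrib diff_divide_distrib)
qed

lemma chol_map_mono:
  assumes "0 \<le> x" "x \<le> y"
  shows "chol_map l b x \<le> chol_map l b y"
proof -
  have "(1 - 1 / l) * x \<le> (1 - 1 / l) * y" using assms l by (intro mult_left_mono) auto
  moreover have "b\<^sup>2 / l * inverse (y + b) \<le> b\<^sup>2 / l * inverse (x + b)"
    using assms l b by (intro mult_left_mono le_imp_inverse_le) auto
  ultimately show ?thesis using assms by (simp add: chol_map_alt)
qed

lemma chol_map_zero: "chol_map l b 0 = 0"
  by (simp add: chol_map_def)

lemma chol_map_nonneg: "0 \<le> x \<Longrightarrow> 0 \<le> chol_map l b x"
  using chol_map_mono[of 0 x] chol_map_zero by simp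

lemma chol_map_concave: "concave_on {0..} (chol_map l b)"
  unfolding concave_on_iff
proof (intro conjI ballI allI impI)
  fix x y u v :: real
  assume xy: "x \<in> {0..}" "y \<in> {0..}" and uv: "0 \<le> u" "0 \<le> v" "u + v = 1"
  have "convex_on {0<..} (inverse :: real \<Rightarrow> real)" by (rule convex_on_inverse) auto
  then have "inverse (u *\<^sub>R (x + b) + v *\<^sub>R (y + b)) \<le> u * inverse (x + b) + v * inverse (y + b)"
    using xy uv b by (auto simp: convex_on_def)
  also have "u *\<^sub>R (x + b) + v *\<^sub>R (y + b) = (u * x + v * y) + b"
    using uv(3) by (simp add: algebra_simps) (metis distrib_left mult.right_neutral)
  finally have conv: "b\<^sup>2 / l * inverse (u * x + v * y + b) \<le> b\<^sup>2 / l * (u * inverse (x + b) + v * inverse (y + b))"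
    using l by (intro mult_left_mono) auto
  have affine: "u * (m * x + d - c * X) + v * (m * y + d - c * Y)
    = m * (u * x + v * y) + d - c * (u * X + v * Y)" for m d c X Y :: real
  proof -
    have "u * d + v * d = d" using uv(3) by (metis distrib_right mult_1)
    then show ?thesis by (simp add: algebra_simps)
  qed
  have nonneg: "0 \<le> x" "0 \<le> y" "0 \<le> u * x + v * y" using xy uv by auto
  show "u * chol_map l b x + v * chol_map l b y \<le> chol_map l b (u *\<^sub>R x + v *\<^sub>R y)"
    unfolding real_scaleR_def chol_map_alt[OF nonneg(1)] chol_map_alt[OF nonneg(2)] chol_map_alt[OF nonneg(3)] affine
    using conv by linarith
qed simp

lemma chol_map_iter_nonneg: "0 \<le> x \<Longrightarrow> 0 \<le> (chol_map l b ^^ k) x"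
  by (induction k) (auto intro: chol_map_nonneg)

lemma chol_map_iter_mono: "0 \<le> x \<Longrightarrow> x \<le> y \<Longrightarrow> (chol_map l b ^^ k) x \<le> (chol_map l b ^^ k) y"
  by (induction k) (auto intro: chol_map_mono chol_map_iter_nonneg)

lemma chol_map_iter_zero: "(chol_map l b ^^ k) 0 = 0"
  by (induction k) (auto simp: chol_map_zero)

text \<open>A concave function after a concave one is concave because the outer one is
  increasing.\<close>

lemma chol_map_iter_concave: "concave_on {0..} (chol_map l b ^^ k)"
proof (induction k)
  case 0
  then show ?case by (simp add: concave_on_iff)
next
  case (Suc k)
  show ?case unfolding concave_on_iff
  proof (intro conjI ballI allI impI)
    fix x y u v :: real
    assume xy: "x \<in> {0..}" "y \<in> {0..}" and uv: "0 \<le> u" "0 \<le> v" "u + v = 1"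
    let ?g = "chol_map l b ^^ k"
    have g: "?g x \<in> {0..}" "?g y \<in> {0..}" using xy chol_map_iter_nonneg by auto
    have "u * chol_map l b (?g x) + v * chol_map l b (?g y) \<le> chol_map l b (u *\<^sub>R ?g x + v *\<^sub>R ?g y)"
      using chol_map_concave g uv unfolding concave_on_iff by blast
    also have "\<dots> \<le> chol_map l b (?g (u *\<^sub>R x + v *\<^sub>R y))"
      using Suc xy uv g unfolding concave_on_iff by (intro chol_map_mono) auto
    finally show "u * (chol_map l b ^^ Suc k) x + v * (chol_map l b ^^ Suc k) y
      \<le> (chol_map l b ^^ Suc k) (u *\<^sub>R x + v *\<^sub>R y)" by simp
  qed simp
qed

text \<open>Discrete counterpart of the differential equation \<open>x' = - x\<^sup>2 / (l (x + b))\<close>, along which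
  \<open>ln x - b / x\<close> decreases at the constant rate \<open>1 / l\<close>.\<close>

lemma chol_map_potential:
  assumes x: "0 < x" and y: "0 < chol_map l b x"
  defines "y \<equiv> chol_map l b x"
  shows "ln y - b / y \<le> ln x - b / x - 1 / l"
proof -
  have y0: "y > 0" using y by (simp add: y_def)
  have "ln (y / x) \<le> y / x - 1" using x y0 by (intro ln_le_minus_one) simp
  then have "ln y \<le> ln x + (y - x) / x" using x y0 by (simp add: ln_div diff_divide_distrib)
  \<comment> \<open>Tangent-line bound for the concave function - b / x at x, the analogue of the
    bound on ln y just obtained.\<close>
  moreover have "- (b / y) \<le> - (b / x) + b * (y - x) / x\<^sup>2"
  proof -
    have "y * (2 * x - y) \<le> x * x" using zero_le_square[of "x - y"] by (simp add: algebra_simps)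
    then have "(2 * x - y) / (x * x) \<le> 1 / y" using x y0 by (simp add: field_simps)
    then have "b * ((2 * x - y) / (x * x)) \<le> b * (1 / y)" using b by (intro mult_left_mono) auto
    moreover have "b * ((2 * x - y) / (x * x)) = b / x - b * (y - x) / x\<^sup>2"
      using x by (simp add: field_simps power2_eq_square)
    ultimately show ?thesis by simp
  qed
  \<comment> \<open>The derivative (x + b) / x^2 of the potential times the step - x^2 / (l (x + b))
    is exactly - 1 / l.\<close>
  moreover have "(y - x) / x + b * (y - x) / x\<^sup>2 = - (1 / l)"
  proof -
    have "(y - x) / x + b * (y - x) / x\<^sup>2 = (y - x) * ((x + b) / x\<^sup>2)"
      using x by (simp add: field_simps power2_eq_square)
    also have "\<dots> = - (1 / l)"
    proof -
      have d: "y - x = - (x\<^sup>2 / (l * (x + b)))" by (simp add: y_def chol_map_def)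
      have "x + b \<noteq> 0" "x\<^sup>2 \<noteq> 0" "l \<noteq> 0" using x b l by auto
      then show ?thesis unfolding d by (simp add: divide_simps)
    qed
    finally show ?thesis .
  qed
  ultimately show ?thesis by simp
qed

lemma chol_map_le: "0 \<le> x \<Longrightarrow> chol_map l b x \<le> x"
  using l b by (simp add: chol_map_def)

lemma chol_map_iter_bound:
  assumes a: "0 \<le> a" and r: "real r \<ge> l * (1 + ln ((a + b) / b))"
  shows "(chol_map l b ^^ r) a \<le> b"
proof (rule ccontr)
  assume "\<not> ?thesis"
  then have big: "(chol_map l b ^^ r) a > b" by simp
  let ?x = "\<lambda>k. (chol_map l b ^^ k) a"
  have dec: "?x r \<le> ?x k" if "k \<le> r" for k
    using that
  proof (induction rule: inc_induct)
    case (step m)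
    then show ?case using chol_map_le[OF chol_map_iter_nonneg[OF a, of m]] by simp
  qed simp
  then have pos: "?x k > 0" if "k \<le> r" for k using big b that by fastforce
  have "ln (?x k) - b / ?x k \<le> ln a - b / a - real k / l" if "k \<le> r" for k
    using that
  proof (induction k)
    case (Suc k)
    then have "ln (?x (Suc k)) - b / ?x (Suc k) \<le> ln (?x k) - b / ?x k - 1 / l"
      using chol_map_potential[of "?x k"] pos[of k] pos[of "Suc k"] by simp
    then show ?case using Suc by (simp add: add_divide_distrib)
  qed simp
  then have le: "ln (?x r) - b / ?x r \<le> ln a - b / a - real r / l" by simp
  have apos: "a > 0" using pos[of 0] by simp
  \<comment> \<open>If the last iterate exceeded \<open>b\<close>, its potential would be above ln b
    - 1, whereas the start is below ln (a + b). The 1 in the step count is the bound on b /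
    x.\<close>
  have "ln b < ln (?x r)" "b / ?x r < 1" using big b by auto
  moreover have "ln a \<le> ln (a + b)" "b / a > 0" using apos b by auto
  ultimately have "real r / l < 1 + (ln (a + b) - ln b)" using le by linarith
  also have "\<dots> = 1 + ln ((a + b) / b)" using apos b by (simp add: ln_div)
  also have "\<dots> \<le> real r / l" using r l by (simp add: field_simps)
  finally show False by simp
qed

end

text \<open>The eigenvectors of \<open>K\<close> (the columns of \<open>V\<close>) are split into the first \<open>l\<close>, along which the mass
  \<open>a\<close> of the residual decays in expectation, and the others, along which the mass never exceeds
  its initial value \<open>b\<close>.\<close>

definition head_mass :: "real mat \<Rightarrow> nat \<Rightarrow> real mat \<Rightarrow> real" where
  "head_mass V l R = (\<Sum>i<l. col V i \<bullet> (R *\<^sub>v col V i))"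

definition tail_mass :: "real mat \<Rightarrow> nat \<Rightarrow> real mat \<Rightarrow> real" where
  "tail_mass V l R = (\<Sum>i\<in>{l..<dim_col V}. col V i \<bullet> (R *\<^sub>v col V i))"

context
  fixes n l :: nat and V :: "real mat" and b :: real
  assumes V: "V \<in> carrier_mat n n" and VtV: "transpose_mat V * V = 1\<^sub>m n" and VVt: "V * transpose_mat V = 1\<^sub>m n"
    and l: "l \<le> n" "0 < l" and b: "0 < b"
begin

lemma V_col: "col V i \<in> carrier_vec n"
  using V by auto

lemma mass_trace:
  assumes "R \<in> carrier_mat n n"
  shows "head_mass V l R + tail_mass V l R = mtrace R"
proof -
  have "{..<n} = {..<l} \<union> {l..<n}" using l by auto
  then have "(\<Sum>i<n. col V i \<bullet> (R *\<^sub>v col V i)) = head_mass V l R + tail_mass V l R"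
    unfolding head_mass_def tail_mass_def using V
    by (simp add: sum.union_disjoint ivl_disj_int)
  then show ?thesis using mtrace_orthonormal[OF assms V VVt] by simp
qed

lemma head_mass_nonneg: "sym_psd n R \<Longrightarrow> 0 \<le> head_mass V l R"
  unfolding head_mass_def by (intro sum_nonneg sym_psdD(3)[OF _ V_col])

lemma tail_mass_nonneg: "sym_psd n R \<Longrightarrow> 0 \<le> tail_mass V l R"
  unfolding tail_mass_def by (intro sum_nonneg sym_psdD(3)[OF _ V_col])

lemma tail_mass_chol_step:
  assumes R: "sym_psd n R" and s: "s < n"
  shows "tail_mass V l (chol_step n R s) \<le> tail_mass V l R"
  unfolding tail_mass_def
proof (rule sum_mono)
  fix i
  have "0 \<le> (col R s \<bullet> col V i)\<^sup>2 / R $$ (s, s)" using psd_diag_nonneg[OF R s] by simp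
  then show "col V i \<bullet> (chol_step n R s *\<^sub>v col V i) \<le> col V i \<bullet> (R *\<^sub>v col V i)"
    by (simp add: chol_step_quadratic[OF R s V_col])
qed

text \<open>Weighting pivot s by R_ss cancels the denominator of the Schur complement, so the mean
  loss along v is |R v|^2 / tr R. Cauchy-Schwarz is used twice: (v . R v)^2 \<le> |R v|^2 for unit
  v, and the square of a sum of \<open>l\<close> terms is at most \<open>l\<close> times the sum of
  squares. Finally tr R \<le> a + b.\<close>

lemma expected_head_mass:
  assumes R: "sym_psd n R" and tr: "mtrace R > 0" and tail: "tail_mass V l R \<le> b"
  shows "(\<Sum>s<n. R $$ (s, s) / mtrace R * head_mass V l (chol_step n R s)) \<le> chol_map (real l) b (head_mass V l R)"
proof -
  note Rc = sym_psdD(1,2)[OF R]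
  let ?a = "head_mass V l R"
  let ?q = "\<lambda>i. col V i \<bullet> (R *\<^sub>v col V i)"
  have one: "(\<Sum>s<n. R $$ (s, s) / mtrace R) = 1"
    using Rc tr by (simp add: mtrace_def sum_divide_distrib[symmetric])
  \<comment> \<open>For a zero diagonal entry the left side is 0 by the division convention; the
    right side is 0 because the whole column vanishes.\<close>
  have term_eq: "R $$ (s, s) / mtrace R * ((col R s \<bullet> col V i)\<^sup>2 / R $$ (s, s)) = (col R s \<bullet> col V i)\<^sup>2 / mtrace R"
    if s: "s < n" for s i
  proof (cases "R $$ (s, s) = 0")
    case True
    then show ?thesis using psd_col_bound[OF R s V_col[of i]] by simp
  qed simp
  have "(\<Sum>s<n. R $$ (s, s) / mtrace R * head_mass V l (chol_step n R s))
    = (\<Sum>s<n. R $$ (s, s) / mtrace R * ?a - (\<Sum>i<l. (col R s \<bullet> col V i)\<^sup>2 / mtrace R))"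
  proof (rule sum.cong[OF refl])
    fix s assume "s \<in> {..<n}"
    then have s: "s < n" by simp
    have "head_mass V l (chol_step n R s) = ?a - (\<Sum>i<l. (col R s \<bullet> col V i)\<^sup>2 / R $$ (s, s))"
      unfolding head_mass_def by (simp add: chol_step_quadratic[OF R s V_col] sum_subtractf)
    then show "R $$ (s, s) / mtrace R * head_mass V l (chol_step n R s)
      = R $$ (s, s) / mtrace R * ?a - (\<Sum>i<l. (col R s \<bullet> col V i)\<^sup>2 / mtrace R)"
      by (simp only: right_diff_distrib sum_distrib_left term_eq[OF s])
  qed
  also have "\<dots> = ?a - (\<Sum>i<l. \<Sum>s<n. (col R s \<bullet> col V i)\<^sup>2 / mtrace R)"
    unfolding sum_subtractf sum_distrib_right[symmetric] one by (subst sum.swap) simp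
  also have "\<dots> = ?a - (\<Sum>i<l. (R *\<^sub>v col V i) \<bullet> (R *\<^sub>v col V i)) / mtrace R"
    by (simp add: sym_sq_norm[OF Rc] sum_divide_distrib)
  also have "\<dots> \<le> ?a - ?a\<^sup>2 / (real l * (?a + b))"
  proof -
    have "(?q i)\<^sup>2 \<le> (R *\<^sub>v col V i) \<bullet> (R *\<^sub>v col V i)" if "i < l" for i
    proof -
      have "col V i \<bullet> col V i = 1"
        using congruence_entry[OF one_carrier_mat V, of i i] VtV V that l
        by (simp add: one_mult_mat_vec[OF V_col])
      then show ?thesis
        using sprod_cauchy_schwarz[OF V_col[of i] mult_mat_vec_carrier[OF Rc(1) V_col[of i]]] by simp
    qed
    then have qR: "(\<Sum>i<l. (?q i)\<^sup>2) \<le> (\<Sum>i<l. (R *\<^sub>v col V i) \<bullet> (R *\<^sub>v col V i))" by (intro sum_mono) simp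
    have "?a\<^sup>2 \<le> real l * (\<Sum>i<l. (?q i)\<^sup>2)"
      using sum_squared_le_sum_of_squares[of ?q "{..<l}"] by (simp add: head_mass_def mult.commute)
    also have "\<dots> \<le> real l * (\<Sum>i<l. (R *\<^sub>v col V i) \<bullet> (R *\<^sub>v col V i))"
      using qR by (intro mult_left_mono) auto
    finally have "?a\<^sup>2 / real l \<le> (\<Sum>i<l. (R *\<^sub>v col V i) \<bullet> (R *\<^sub>v col V i))"
      using l by (simp add: pos_divide_le_eq mult.commute)
    then have "?a\<^sup>2 / real l / mtrace R \<le> (\<Sum>i<l. (R *\<^sub>v col V i) \<bullet> (R *\<^sub>v col V i)) / mtrace R"
      using tr by (intro divide_right_mono) auto
    moreover have "?a\<^sup>2 / real l / (?a + b) \<le> ?a\<^sup>2 / real l / mtrace R"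
      using mass_trace[OF Rc(1)] tail tr by (intro divide_left_mono) auto
    ultimately show ?thesis by (simp add: divide_divide_eq_left)
  qed
  finally show ?thesis by (simp add: chol_map_def)
qed

text \<open>Conditioning on the first pivot: the induction hypothesis applies to each successor,
  Jensen moves the mean inside the concave iterate, and monotonicity inserts the one-step
  bound.\<close>

lemma rpc_expected_head_mass:
  "sym_psd n R \<Longrightarrow> tail_mass V l R \<le> b \<Longrightarrow>
    measure_pmf.expectation (rpc n R k) (\<lambda>F. head_mass V l (R - gram_cols n F))
      \<le> (chol_map (real l) b ^^ k) (head_mass V l R)"
proof (induction k arbitrary: R)
  case 0
  then show ?case using minus_zero_gram[OF sym_psdD(1)[OF 0(1)], of 0] by simp
next
  case (Suc k)
  note R = Suc.prems(1) and Rc = sym_psdD(1)[OF Suc.prems(1)]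
  have l1: "1 \<le> real l" using l by simp
  show ?case
  proof (cases "mtrace R > 0")
    case True
    let ?h = "\<lambda>F. head_mass V l (R - gram_cols n F)"
    let ?p = "\<lambda>s. R $$ (s, s) / mtrace R"
    have ex: "measure_pmf.expectation (rpc n R (Suc k)) ?h
      = (\<Sum>s\<in>set_pmf (pivot_pmf n R). pmf (pivot_pmf n R) s *\<^sub>R
          measure_pmf.expectation (map_pmf ((#) (pivot_col R s)) (rpc n (chol_step n R s) k)) ?h)"
      unfolding rpc_Suc[OF True]
      by (rule pmf_expectation_bind) (use finite_rpc[OF chol_step_psd[OF R]] set_pivot_pmf[OF R True] in auto)
    also have "\<dots> = (\<Sum>s\<in>set_pmf (pivot_pmf n R). ?p s *
          measure_pmf.expectation (rpc n (chol_step n R s) k) (\<lambda>F. head_mass V l (chol_step n R s - gram_cols n F)))"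
      by (rule sum.cong) (use set_pivot_pmf[OF R True] in \<open>auto simp: pivot_pmf[OF R True] residual_Cons[OF Rc]\<close>)
    also have "\<dots> \<le> (\<Sum>s\<in>set_pmf (pivot_pmf n R). ?p s * (chol_map (real l) b ^^ k) (head_mass V l (chol_step n R s)))"
    proof (rule sum_mono)
      fix s assume "s \<in> set_pmf (pivot_pmf n R)"
      then have s: "s < n" "R $$ (s, s) > 0" using set_pivot_pmf[OF R True] by auto
      have "tail_mass V l (chol_step n R s) \<le> b" using tail_mass_chol_step[OF R s(1)] Suc.prems(2) by simp
      from Suc.IH[OF chol_step_psd[OF R s(1)] this]
      show "?p s * measure_pmf.expectation (rpc n (chol_step n R s) k) (\<lambda>F. head_mass V l (chol_step n R s - gram_cols n F))
        \<le> ?p s * (chol_map (real l) b ^^ k) (head_mass V l (chol_step n R s))"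
        using s True by (intro mult_left_mono) auto
    qed
    \<comment> \<open>Pivots of probability zero are added so that the weights are indexed by all s
      < n.\<close>
    also have "\<dots> = (\<Sum>s<n. ?p s * (chol_map (real l) b ^^ k) (head_mass V l (chol_step n R s)))"
      unfolding set_pivot_pmf[OF R True]
      by (rule sum.mono_neutral_left) (use psd_diag_nonneg[OF R] in \<open>force simp: not_less\<close>)+
    also have "\<dots> \<le> (chol_map (real l) b ^^ k) (\<Sum>s<n. ?p s *\<^sub>R head_mass V l (chol_step n R s))"
    proof (rule concave_on_sum)
      show "concave_on {0..} (chol_map (real l) b ^^ k)" by (rule chol_map_iter_concave[OF l1 b])
      show "{..<n} \<noteq> {}" using l by (simp add: lessThan_empty_iff bot_nat_def)
      show "(\<Sum>s<n. ?p s) = 1" using Rc True by (simp add: mtrace_def sum_divide_distrib[symmetric])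
      show "0 \<le> ?p s" if "s \<in> {..<n}" for s using psd_diag_nonneg[OF R] that True by simp
      show "head_mass V l (chol_step n R s) \<in> {0..}" if "s \<in> {..<n}" for s
        using head_mass_nonneg[OF chol_step_psd[OF R]] that by simp
    qed simp
    also have "\<dots> \<le> (chol_map (real l) b ^^ k) (chol_map (real l) b (head_mass V l R))"
    proof (rule chol_map_iter_mono[OF l1 b])
      show "0 \<le> (\<Sum>s<n. ?p s *\<^sub>R head_mass V l (chol_step n R s))"
        using psd_diag_nonneg[OF R] head_mass_nonneg[OF chol_step_psd[OF R]] True by (intro sum_nonneg) auto
      show "(\<Sum>s<n. ?p s *\<^sub>R head_mass V l (chol_step n R s)) \<le> chol_map (real l) b (head_mass V l R)"
        using expected_head_mass[OF R True Suc.prems(2)] by simp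
    qed
    \<comment> \<open>The first pivot contributes the innermost application, hence the right-hand
      unfolding of the power.\<close>
    also have "\<dots> = (chol_map (real l) b ^^ Suc k) (head_mass V l R)" by (simp only: funpow_Suc_right o_apply)
    finally show ?thesis .
  next
    case False
    \<comment> \<open>Zero trace forces zero head mass, and 0 is a fixed point of the
      iteration.\<close>
    then have "head_mass V l R = 0"
      using mass_trace[OF Rc] tail_mass_nonneg[OF R] head_mass_nonneg[OF R] by simp
    then show ?thesis using False minus_zero_gram[OF Rc, of "Suc k"]
      by (simp add: rpc_degenerate chol_map_iter_zero[OF l1 b] del: funpow.simps rpc.simps)
  qed
qed

lemma tail_mass_residual:
  assumes R: "sym_psd n R" and F: "F \<in> set_pmf (rpc n R k)"
  shows "tail_mass V l (R - gram_cols n F) \<le> tail_mass V l R"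
  unfolding tail_mass_def
proof (rule sum_mono)
  fix i
  have "sym_psd n (gram_cols n F)" using gram_cols_psd rpc_residual_psd[OF R F] by blast
  then have "0 \<le> col V i \<bullet> (gram_cols n F *\<^sub>v col V i)" by (rule sym_psdD(3)[OF _ V_col])
  then show "col V i \<bullet> ((R - gram_cols n F) *\<^sub>v col V i) \<le> col V i \<bullet> (R *\<^sub>v col V i)"
    using sym_psdD(1)[OF R] V_col[of i]
    by (simp add: minus_mult_distrib_mat_vec[of _ n n] scalar_prod_minus_distrib[of _ n] mult_mat_vec_carrier[of _ n n])
qed

text \<open>One \<open>b\<close> bounds the head mass after enough steps, the other the tail mass,
  which holds for every outcome.\<close>

lemma rpc_expected_trace:
  assumes R: "sym_psd n R" and tail: "tail_mass V l R \<le> b"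
    and k: "real k \<ge> real l * (1 + ln ((head_mass V l R + b) / b))"
  shows "measure_pmf.expectation (rpc n R k) (\<lambda>F. mtrace (R - gram_cols n F)) \<le> 2 * b"
proof -
  note int = integrable_measure_pmf_finite[OF finite_rpc[OF R]]
  have "measure_pmf.expectation (rpc n R k) (\<lambda>F. mtrace (R - gram_cols n F))
    \<le> measure_pmf.expectation (rpc n R k) (\<lambda>F. head_mass V l (R - gram_cols n F) + b)"
  proof (rule integral_mono_AE[OF int int], unfold AE_measure_pmf_iff, rule ballI)
    fix F assume F: "F \<in> set_pmf (rpc n R k)"
    have "R - gram_cols n F \<in> carrier_mat n n" using rpc_residual_psd[OF R F] sym_psdD(1) by blast
    then show "mtrace (R - gram_cols n F) \<le> head_mass V l (R - gram_cols n F) + b"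
      using mass_trace tail_mass_residual[OF R F] tail by fastforce
  qed
  also have "\<dots> = measure_pmf.expectation (rpc n R k) (\<lambda>F. head_mass V l (R - gram_cols n F)) + b"
    by (subst Bochner_Integration.integral_add) (auto intro: int)
  also have "\<dots> \<le> (chol_map (real l) b ^^ k) (head_mass V l R) + b"
    using rpc_expected_head_mass[OF R tail] by simp
  also have "\<dots> \<le> b + b"
    using chol_map_iter_bound[OF _ b head_mass_nonneg[OF R] k] l by simp
  finally show ?thesis by simp
qed

end

section \<open>The preconditioner\<close>

lemma eigs_quadratic:
  assumes "K \<in> carrier_mat n n" "V \<in> carrier_mat n n" "transpose_mat V * K * V = mat_diag n (\<lambda>i. eigs K ! i)" "i < n"
  shows "col V i \<bullet> (K *\<^sub>v col V i) = eigs K ! i"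
  using congruence_entry[OF assms(1,2,4,4)] assms(3,4) by (simp add: mat_diag_def)

lemma mtrace_eigs:
  assumes K: "K \<in> carrier_mat n n" "transpose_mat K = K"
  shows "mtrace K = (\<Sum>i<n. eigs K ! i)"
proof -
  obtain V where V: "V \<in> carrier_mat n n" "transpose_mat V * V = 1\<^sub>m n" "V * transpose_mat V = 1\<^sub>m n"
    "transpose_mat V * K * V = mat_diag n (\<lambda>i. eigs K ! i)" "K * V = V * mat_diag n (\<lambda>i. eigs K ! i)"
    using spectral_theorem[OF K] .
  show ?thesis using mtrace_orthonormal[OF K(1) V(1,3)] eigs_quadratic[OF K(1) V(1,4)] by simp
qed

text \<open>With repeated eigenvalues the chosen approximation depends on the eigenbasis, but its
  trace uses only that the vectors have length 1. The columns of a spectral basis show that a choice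
  exists.\<close>

lemma mtrace_best_rank_approx:
  assumes K: "K \<in> carrier_mat n n" "transpose_mat K = K" and l: "l \<le> n"
  shows "mtrace (K - best_rank_approx K l) = eig_tail K l"
proof -
  obtain V where V: "V \<in> carrier_mat n n" "transpose_mat V * V = 1\<^sub>m n" "V * transpose_mat V = 1\<^sub>m n"
    "transpose_mat V * K * V = mat_diag n (\<lambda>i. eigs K ! i)" "K * V = V * mat_diag n (\<lambda>i. eigs K ! i)"
    using spectral_theorem[OF K] .
  let ?good = "\<lambda>B vs. length vs = dim_row K \<and>
      (\<forall>i < dim_row K. vs ! i \<in> carrier_vec (dim_row K) \<and> K *\<^sub>v (vs ! i) = eigs K ! i \<cdot>\<^sub>v (vs ! i)) \<and>
      (\<forall>i < dim_row K. \<forall>j < dim_row K. scalar_prod (vs ! i) (vs ! j) = (if i = j then 1 else 0)) \<and>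
      B = mat (dim_row K) (dim_row K) (\<lambda>(p, q). \<Sum>i<l. eigs K ! i * vec_index (vs ! i) p * vec_index (vs ! i) q)"
  let ?cols = "map (col V) [0..<n]"
  have eig: "K *\<^sub>v col V i = eigs K ! i \<cdot>\<^sub>v col V i" if i: "i < n" for i
  proof -
    have "K *\<^sub>v col V i = col (V * mat_diag n (\<lambda>i. eigs K ! i)) i"
      using col_mult2[OF K(1) V(1) i] V(5) by simp
    also have "\<dots> = eigs K ! i \<cdot>\<^sub>v col V i"
      by (rule eq_vecI) (use V(1) i in \<open>auto simp: mat_diag_mult_right[of _ n]\<close>)
    finally show ?thesis .
  qed
  have orth: "col V i \<bullet> col V j = (if i = j then 1 else 0)" if "i < n" "j < n" for i j
  proof -
    have "(transpose_mat V * V) $$ (i, j) = col V i \<bullet> col V j" using V(1) that by simp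
    then show ?thesis using V(2) that by simp
  qed
  have "?good (mat n n (\<lambda>(p, q). \<Sum>i<l. eigs K ! i * vec_index (?cols ! i) p * vec_index (?cols ! i) q)) ?cols"
    using K(1) V(1) eig orth by auto
  then have "\<exists>B vs. ?good B vs" by blast
  then have "\<exists>vs. ?good (best_rank_approx K l) vs" unfolding best_rank_approx_def by (rule someI_ex)
  then obtain vs where vs: "?good (best_rank_approx K l) vs" by blast
  define B where "B = best_rank_approx K l"
  have B: "B = mat n n (\<lambda>(p, q). \<Sum>i<l. eigs K ! i * (vs ! i) $ p * (vs ! i) $ q)"
    and vv: "\<And>i. i < n \<Longrightarrow> vs ! i \<bullet> vs ! i = 1" and vc: "\<And>i. i < n \<Longrightarrow> vs ! i \<in> carrier_vec n"
    using vs K(1) by (auto simp: B_def)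
  have "mtrace (K - B) = (\<Sum>p<n. K $$ (p, p) - (\<Sum>i<l. eigs K ! i * ((vs ! i) $ p * (vs ! i) $ p)))"
    using K(1) by (simp add: mtrace_def B mult.assoc)
  also have "\<dots> = mtrace K - (\<Sum>i<l. \<Sum>p<n. eigs K ! i * ((vs ! i) $ p * (vs ! i) $ p))"
    using K(1) unfolding sum_subtractf by (subst (2) sum.swap) (simp add: mtrace_def)
  also have "(\<Sum>i<l. \<Sum>p<n. eigs K ! i * ((vs ! i) $ p * (vs ! i) $ p)) = (\<Sum>i<l. eigs K ! i)"
  proof (rule sum.cong[OF refl])
    fix i assume "i \<in> {..<l}"
    then have i: "i < n" using l by simp
    show "(\<Sum>p<n. eigs K ! i * ((vs ! i) $ p * (vs ! i) $ p)) = eigs K ! i"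
      using vv[OF i] vc[OF i] by (simp add: sum_distrib_left[symmetric] scalar_prod_def atLeast0LessThan)
  qed
  also have "mtrace K = (\<Sum>i<l. eigs K ! i) + eig_tail K l"
  proof -
    have "{..<n} = {..<l} \<union> {l..<n}" using l by auto
    then show ?thesis using K(1) unfolding mtrace_eigs[OF K] eig_tail_def
      by (simp add: sum.union_disjoint ivl_disj_int)
  qed
  finally show ?thesis by (simp add: B_def)
qed

text \<open>The least index exists because the tail from n on is an empty sum.\<close>

lemma tail_rank:
  assumes "K \<in> carrier_mat n n" "0 \<le> \<mu>"
  shows "tail_rank \<mu> K \<le> n" "eig_tail K (tail_rank \<mu> K) \<le> \<mu>"
proof -
  have "eig_tail K n \<le> \<mu>" using assms by (simp add: eig_tail_def)
  then show "tail_rank \<mu> K \<le> n" "eig_tail K (tail_rank \<mu> K) \<le> \<mu>"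
    unfolding tail_rank_def by (rule Least_le, rule LeastI)
qed

section \<open>The residual trace in mean and in probability\<close>

lemma rpc_trace_mono:
  assumes R: "sym_psd n R" and F: "F \<in> set_pmf (rpc n R k)"
  shows "mtrace (R - gram_cols n F) \<le> mtrace R"
proof -
  have "0 \<le> mtrace (gram_cols n F)"
    using mtrace_nonneg gram_cols_psd rpc_residual_psd[OF R F] by blast
  moreover have "mtrace (R - gram_cols n F) = mtrace R - mtrace (gram_cols n F)"
    using sym_psdD(1)[OF R] by (simp add: mtrace_def sum_subtractf gram_cols_def)
  ultimately show ?thesis by simp
qed

lemma RPCholesky_trace_bound:
  assumes K: "sym_psd n K" and \<mu>: "\<mu> > 0"
    and r: "r \<ge> n \<or>
       (mtrace (K - best_rank_approx K (tail_rank \<mu> K)) > 0 \<and>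
        real r \<ge> real (tail_rank \<mu> K) *
          (1 + ln (mtrace K / mtrace (K - best_rank_approx K (tail_rank \<mu> K)))))"
  shows "measure_pmf.expectation (rpc n K r) (\<lambda>F. mtrace (K - gram_cols n F)) \<le> 2 * \<mu>"
proof -
  note Kc = sym_psdD(1,2)[OF K]
  note int = integrable_measure_pmf_finite[OF finite_rpc[OF K]]
  have bound: ?thesis if "\<And>F. F \<in> set_pmf (rpc n K r) \<Longrightarrow> mtrace (K - gram_cols n F) \<le> 2 * \<mu>"
  proof -
    have "measure_pmf.expectation (rpc n K r) (\<lambda>F. mtrace (K - gram_cols n F))
      \<le> measure_pmf.expectation (rpc n K r) (\<lambda>F. 2 * \<mu>)"
      by (rule integral_mono_AE[OF int int]) (use that in \<open>simp add: AE_measure_pmf_iff\<close>)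
    then show ?thesis by simp
  qed
  let ?l = "tail_rank \<mu> K"
  note tr = tail_rank[OF Kc(1) less_imp_le[OF \<mu>]]
  note best = mtrace_best_rank_approx[OF Kc tr(1)]
  show ?thesis
  proof (cases "r \<ge> n")
    case True
    have "card {j. j < n \<and> K $$ (j, j) \<noteq> 0} \<le> card {..<n}" by (intro card_mono) auto
    then show ?thesis using rpc_exact[OF K, of r] True \<mu> by (intro bound) simp
  next
    case False
    define b where "b = eig_tail K ?l"
    have b: "b > 0" and rb: "real r \<ge> real ?l * (1 + ln (mtrace K / b))"
      using r False best by (auto simp: b_def)
    show ?thesis
    \<comment> \<open>The recursion divides by \<open>l\<close>; for l = 0 the initial trace is
      within \<open>\<mu>\<close> and never grows.\<close>
    proof (cases "?l = 0")
      case True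
      have "mtrace K = eig_tail K 0"
        using mtrace_eigs[OF Kc] Kc(1) by (simp add: eig_tail_def atLeast0LessThan)
      then have "mtrace K \<le> \<mu>" using tr(2) True by simp
      then show ?thesis using rpc_trace_mono[OF K] \<mu> by (intro bound) force
    next
      case l0: False
      obtain V where V: "V \<in> carrier_mat n n" "transpose_mat V * V = 1\<^sub>m n" "V * transpose_mat V = 1\<^sub>m n"
        "transpose_mat V * K * V = mat_diag n (\<lambda>i. eigs K ! i)" "K * V = V * mat_diag n (\<lambda>i. eigs K ! i)"
        using spectral_theorem[OF Kc] .
      have l: "?l \<le> n" "0 < ?l" using tr(1) l0 by auto
      have tm: "tail_mass V ?l K = b"
        using V(1) Kc(1) eigs_quadratic[OF Kc(1) V(1,4)] by (simp add: tail_mass_def b_def eig_tail_def)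
      have "head_mass V ?l K + b = mtrace K"
        using mass_trace[OF V(1-3) l b Kc(1)] tm by simp
      then have "measure_pmf.expectation (rpc n K r) (\<lambda>F. mtrace (K - gram_cols n F)) \<le> 2 * b"
        using rpc_expected_trace[OF V(1-3) l b K] tm rb by simp
      then show ?thesis using tr(2) by (simp add: b_def)
    qed
  qed
qed

text \<open>Markov's inequality bounds the probability of the complementary event. The event is cut
  down to the support so that each member is an actual output, with semidefinite residual.\<close>

lemma RPCholesky_trace_prob:
  assumes K: "sym_psd n K" and \<mu>: "\<mu> > 0" and \<delta>: "0 < \<delta>"
    and ex: "measure_pmf.expectation (rpc n K r) (\<lambda>F. mtrace (K - gram_cols n F)) \<le> 2 * \<mu>"
  shows "measure_pmf.prob (rpc n K r) {F \<in> set_pmf (rpc n K r). mtrace (K - gram_cols n F) \<le> 2 * \<mu> / \<delta>} \<ge> 1 - \<delta>"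
proof -
  let ?p = "rpc n K r" and ?t = "\<lambda>F. mtrace (K - gram_cols n F)"
  let ?bad = "{F. ?t F \<ge> 2 * \<mu> / \<delta>}"
  note int = integrable_measure_pmf_finite[OF finite_rpc[OF K]]
  have nn: "0 \<le> ?t F" if "F \<in> set_pmf ?p" for F
    using mtrace_nonneg rpc_residual_psd[OF K that] by blast
  have c: "2 * \<mu> / \<delta> > 0" using \<mu> \<delta> by simp
  have "measure_pmf.prob ?p {F \<in> space (measure_pmf ?p). 2 * \<mu> / \<delta> \<le> ?t F} \<le> measure_pmf.expectation ?p ?t / (2 * \<mu> / \<delta>)"
    by (rule integral_Markov_inequality_measure[OF int _ _ c, where A = UNIV])
      (use nn in \<open>auto simp: AE_measure_pmf_iff\<close>)
  also have "\<dots> \<le> 2 * \<mu> / (2 * \<mu> / \<delta>)" using ex c by (intro divide_right_mono) auto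
  also have "\<dots> = \<delta>" using \<mu> \<delta> by simp
  finally have "measure_pmf.prob ?p ?bad \<le> \<delta>" by simp
  moreover have "measure_pmf.prob ?p (- ?bad) = 1 - measure_pmf.prob ?p ?bad"
    using measure_pmf.prob_compl[of ?bad ?p] by (simp add: Compl_eq_Diff_UNIV)
  moreover have "measure_pmf.prob ?p (- ?bad) = measure_pmf.prob ?p (- ?bad \<inter> set_pmf ?p)"
    by (simp add: measure_Int_set_pmf)
  moreover have "measure_pmf.prob ?p (- ?bad \<inter> set_pmf ?p) \<le> measure_pmf.prob ?p {F \<in> set_pmf ?p. ?t F \<le> 2 * \<mu> / \<delta>}"
    by (intro measure_pmf.finite_measure_mono) auto
  ultimately show ?thesis by linarith
qed

section \<open>Deterministic consequences of a small residual trace\<close>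

lemma ones_mat_psd: "sym_psd n (ones_mat n)"
proof -
  let ?e = "vec n (\<lambda>_. 1 :: real)"
  have "ones_mat n = outer n ?e" by (rule eq_matI) (auto simp: ones_mat_def outer_def)
  then show ?thesis using outer_quadratic[of ?e n] by (simp add: sym_psd_def outer_transpose)
qed

lemma quadratic_add:
  assumes "A \<in> carrier_mat n n" "B \<in> carrier_mat n n" "x \<in> carrier_vec n"
  shows "x \<bullet> ((A + B) *\<^sub>v x) = x \<bullet> (A *\<^sub>v x) + x \<bullet> (B *\<^sub>v (x :: real vec))"
  using assms by (simp add: add_mult_distrib_mat_vec[of _ n n] scalar_prod_add_distrib[of _ n] mult_mat_vec_carrier[of _ n n])

lemma quadratic_smult:
  assumes "A \<in> carrier_mat n n" "x \<in> carrier_vec n"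
  shows "x \<bullet> ((c \<cdot>\<^sub>m A) *\<^sub>v x) = c * (x \<bullet> (A *\<^sub>v (x :: real vec)))"
proof -
  have "(c \<cdot>\<^sub>m A) *\<^sub>v x = c \<cdot>\<^sub>v (A *\<^sub>v x)"
    by (rule eq_vecI) (use assms in \<open>auto simp: smult_scalar_prod_distrib[of _ n]\<close>)
  then show ?thesis using assms by (simp add: scalar_prod_smult_distrib[of _ n] mult_mat_vec_carrier[of _ n n])
qed

lemma add_residual:
  fixes K G C L :: "real mat"
  assumes "K \<in> carrier_mat n n" "G \<in> carrier_mat n n" "C \<in> carrier_mat n n" "L \<in> carrier_mat n n"
  shows "K + C + L = G + C + L + (K - G)"
  by (rule eq_matI) (use assms in auto)

text \<open>The chain R \<le> (tr R) I \<le> (2 / \<delta>) \<open>\<mu>\<close> I \<le> (2 /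
  \<delta>) P in the Loewner order gives P \<le> A \<le> (1 + 2 / \<delta>) P; randomness enters
  only through the bound on the trace.\<close>

theorem preconditioner_quality:
  fixes K L :: "real mat"
  assumes n: "n > 0" and K: "sym_psd n K" and \<mu>: "\<mu> > 0" and \<delta>: "0 < \<delta>" "\<delta> < 1" and c: "0 \<le> c"
    and L: "L \<in> carrier_mat n n" "transpose_mat L = L" "loewner_ge n L (\<mu> \<cdot>\<^sub>m 1\<^sub>m n)"
    and F: "set F \<subseteq> carrier_vec n" "sym_psd n (K - gram_cols n F)" "mtrace (K - gram_cols n F) \<le> 2 * \<mu> / \<delta>"
  defines "P \<equiv> gram_cols n F + c \<cdot>\<^sub>m ones_mat n + L"
    and "A \<equiv> K + c \<cdot>\<^sub>m ones_mat n + L"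
  shows "cond_num (mat_inv (mat_sqrt P) * A * mat_inv (mat_sqrt P)) \<le> 3 / \<delta>"
    and "\<lbrakk>b \<in> carrier_vec n; 0 < \<epsilon>; \<epsilon> < 1; real t \<ge> \<delta> powr (-1/2) * ln (2 / \<epsilon>)\<rbrakk> \<Longrightarrow>
      A_norm A (pcg A P b t - mat_inv A *\<^sub>v b) \<le> \<epsilon> * A_norm A (mat_inv A *\<^sub>v b)"
proof -
  define R where "R = K - gram_cols n F"
  note G = gram_cols_psd[OF F(1)]
  note O = ones_mat_psd[of n]
  note Gc = sym_psdD(1,2)[OF G] and Oc = sym_psdD(1,2)[OF O] and Kc = sym_psdD(1,2)[OF K]
  have Rp: "sym_psd n R" using F(2) by (simp add: R_def)
  note Rc = sym_psdD(1,2)[OF Rp]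
  have cO: "c \<cdot>\<^sub>m ones_mat n \<in> carrier_mat n n" "transpose_mat (c \<cdot>\<^sub>m ones_mat n) = c \<cdot>\<^sub>m ones_mat n"
    by (auto simp: ones_mat_def intro!: eq_matI)
  have sum_sym: "transpose_mat (X + Y) = X + Y"
    if "X \<in> carrier_mat n n" "transpose_mat X = X" "Y \<in> carrier_mat n n" "transpose_mat Y = Y" for X Y :: "real mat"
    using that transpose_add[of X n n Y] by simp
  have P: "P \<in> carrier_mat n n" "transpose_mat P = P"
    unfolding P_def using Gc cO L sum_sym by simp_all
  have AP: "A = P + R"
    unfolding A_def P_def R_def by (rule add_residual[OF Kc(1) Gc(1) cO(1) L(1)])
  have A: "A \<in> carrier_mat n n" "transpose_mat A = A"
    unfolding AP using P Rc sum_sym by simp_all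
  have Pge: "\<mu> * (x \<bullet> x) \<le> x \<bullet> (P *\<^sub>v x)" if x: "x \<in> carrier_vec n" for x
  proof -
    have I: "\<mu> \<cdot>\<^sub>m 1\<^sub>m n \<in> carrier_mat n n" by simp
    have "L = (L - \<mu> \<cdot>\<^sub>m 1\<^sub>m n) + \<mu> \<cdot>\<^sub>m 1\<^sub>m n" by (rule eq_matI) (use L in auto)
    then have "x \<bullet> (L *\<^sub>v x) = x \<bullet> ((L - \<mu> \<cdot>\<^sub>m 1\<^sub>m n) *\<^sub>v x) + x \<bullet> ((\<mu> \<cdot>\<^sub>m 1\<^sub>m n) *\<^sub>v x)"
      using quadratic_add[OF minus_carrier_mat[OF I] I x] by metis
    then have "\<mu> * (x \<bullet> x) \<le> x \<bullet> (L *\<^sub>v x)"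
      using L(3) x quadratic_smult[OF one_carrier_mat x, of \<mu>] by (simp add: loewner_ge_def sym_psd_def)
    moreover have "x \<bullet> (P *\<^sub>v x) = x \<bullet> (gram_cols n F *\<^sub>v x) + c * (x \<bullet> (ones_mat n *\<^sub>v x)) + x \<bullet> (L *\<^sub>v x)"
      unfolding P_def quadratic_add[OF add_carrier_mat[OF cO(1)] L(1) x] quadratic_add[OF Gc(1) cO(1) x]
      by (simp add: quadratic_smult[OF Oc(1) x])
    ultimately show ?thesis using sym_psdD(3)[OF G x] mult_nonneg_nonneg[OF c sym_psdD(3)[OF O x]] by linarith
  qed
  have pos: "0 < x \<bullet> (P *\<^sub>v x)" if x: "x \<in> carrier_vec n" "x \<noteq> 0\<^sub>v n" for x
    using Pge[OF x(1)] mult_pos_pos[OF \<mu> sprod_self_pos[OF x]] by linarith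
  have Aq: "x \<bullet> (A *\<^sub>v x) = x \<bullet> (P *\<^sub>v x) + x \<bullet> (R *\<^sub>v x)" if x: "x \<in> carrier_vec n" for x
    unfolding AP by (rule quadratic_add[OF P(1) Rc(1) x])
  have lower: "x \<bullet> (P *\<^sub>v x) \<le> x \<bullet> (A *\<^sub>v x)" if x: "x \<in> carrier_vec n" for x
    using Aq[OF x] sym_psdD(3)[OF Rp x] by simp
  have upper: "x \<bullet> (A *\<^sub>v x) \<le> (1 + 2 / \<delta>) * (x \<bullet> (P *\<^sub>v x))" if x: "x \<in> carrier_vec n" for x
  proof -
    have "x \<bullet> (R *\<^sub>v x) \<le> mtrace R * (x \<bullet> x)" by (rule psd_le_trace[OF Rp x])
    also have "\<dots> \<le> 2 * \<mu> / \<delta> * (x \<bullet> x)"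
      using F(3) sprod_self_nonneg[of x] by (intro mult_right_mono) (auto simp: R_def)
    also have "\<dots> = 2 / \<delta> * (\<mu> * (x \<bullet> x))" by simp
    also have "\<dots> \<le> 2 / \<delta> * (x \<bullet> (P *\<^sub>v x))" using Pge[OF x] \<delta> by (intro mult_left_mono) auto
    finally show ?thesis using Aq[OF x] by (simp add: distrib_right)
  qed
  note spec = preconditioned_spectrum[OF A P pos lower upper]
  define M where "M = mat_inv (mat_sqrt P) * A * mat_inv (mat_sqrt P)"
  have "length (eigs M) = n" using spec(1) by (simp add: M_def)
  moreover have "1 \<le> eigs M ! i \<and> eigs M ! i \<le> 1 + 2 / \<delta>" if "i < n" for i
    using spec(2) that by (simp add: M_def)
  ultimately have "cond_num M \<le> 1 + 2 / \<delta>" using n by (intro cond_num_le) auto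
  also have "\<dots> \<le> 3 / \<delta>" using \<delta> by (simp add: field_simps)
  finally show "cond_num (mat_inv (mat_sqrt P) * A * mat_inv (mat_sqrt P)) \<le> 3 / \<delta>" by (simp add: M_def)
  assume b: "b \<in> carrier_vec n" and \<epsilon>: "0 < \<epsilon>" "\<epsilon> < 1"
    and t: "real t \<ge> \<delta> powr (-1/2) * ln (2 / \<epsilon>)"
  have Apos: "0 < x \<bullet> (A *\<^sub>v x)" if "x \<in> carrier_vec n" "x \<noteq> 0\<^sub>v n" for x
    using pos[OF that] lower[OF that(1)] by simp
  have "mat_inv A \<in> carrier_mat n n" using inverse_sqrt(1,4)[OF A Apos] by simp
  then have x: "mat_inv A *\<^sub>v b \<in> carrier_vec n" using b by simp
  have "0 \<le> \<mu> * ((mat_inv A *\<^sub>v b) \<bullet> (mat_inv A *\<^sub>v b))"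
    using \<mu> sprod_self_nonneg by (intro mult_nonneg_nonneg) auto
  then have "0 \<le> A_norm A (mat_inv A *\<^sub>v b)"
    using Pge[OF x] lower[OF x] by (simp add: A_norm_def)
  moreover have "A_norm A (pcg A P b t - mat_inv A *\<^sub>v b)
      \<le> 2 * ((sqrt (1 + 2 / \<delta>) - 1) / (sqrt (1 + 2 / \<delta>) + 1)) ^ t * A_norm A (mat_inv A *\<^sub>v b)"
    by (rule pcg_convergence[OF A P pos lower upper _ b]) (use \<delta> in auto)
  ultimately show "A_norm A (pcg A P b t - mat_inv A *\<^sub>v b) \<le> \<epsilon> * A_norm A (mat_inv A *\<^sub>v b)"
    using cheb_rate_le[OF \<delta> \<epsilon> t] by (meson mult_right_mono order_trans)
qed

text \<open>The disjunction in \<open>r_bound\<close> renders the minimum. If the tail trace is 0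
  the logarithm is infinite and the minimum is n; the positivity guard keeps the convention x / 0 =
  0 from turning this case into a weaker demand on \<open>r\<close>. A single event serves all
  \<open>b\<close> and \<open>t\<close>.\<close>

theorem theorem3:
  fixes K L :: "real mat" and n r :: nat and \<mu> \<delta> \<epsilon> lam sigma_k :: real
  assumes "n > 0"
    and K: "sym_psd n K"
    and "\<mu> > 0" and "0 < \<delta>" and "\<delta> < 1" and "0 < \<epsilon>" and "\<epsilon> < 1"
    and "lam > 0" and "sigma_k > 0"
    and "r \<le> n"
    and r_bound: "r \<ge> n \<or>
       (mtrace (K - best_rank_approx K (tail_rank \<mu> K)) > 0 \<and>
        real r \<ge> real (tail_rank \<mu> K) *
          (1 + ln (mtrace K / mtrace (K - best_rank_approx K (tail_rank \<mu> K)))))"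
    and L: "L \<in> carrier_mat n n" "transpose_mat L = L" "loewner_ge n L (\<mu> \<cdot>\<^sub>m 1\<^sub>m n)"
  shows "measure_pmf.prob (RPCholesky K r)
     {F. let P = gram_cols n F + (lam * sigma_k) \<cdot>\<^sub>m ones_mat n + L;
             A = K + (lam * sigma_k) \<cdot>\<^sub>m ones_mat n + L;
             S = mat_inv (mat_sqrt P)
         in cond_num (S * A * S) \<le> 3 / \<delta> \<and>
            (\<forall>b \<in> carrier_vec n. \<forall>t :: nat.
               real t \<ge> \<delta> powr (-1/2) * ln (2 / \<epsilon>) \<longrightarrow>
               A_norm A (pcg A P b t - mat_inv A *\<^sub>v b) \<le> \<epsilon> * A_norm A (mat_inv A *\<^sub>v b))}
     \<ge> 1 - \<delta>"
    (is "measure_pmf.prob _ ?good \<ge> _")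
proof -
  have rpc: "RPCholesky K r = rpc n K r" using sym_psdD(1)[OF K] by (simp add: RPCholesky_def)
  let ?T = "{F \<in> set_pmf (rpc n K r). mtrace (K - gram_cols n F) \<le> 2 * \<mu> / \<delta>}"
  have c: "0 \<le> lam * sigma_k" using assms by simp
  have "?T \<subseteq> ?good"
  proof
    fix F assume "F \<in> ?T"
    then have F: "set F \<subseteq> carrier_vec n" "sym_psd n (K - gram_cols n F)" "mtrace (K - gram_cols n F) \<le> 2 * \<mu> / \<delta>"
      using rpc_residual_psd[OF K] by auto
    note quality = preconditioner_quality[OF \<open>n > 0\<close> K \<open>\<mu> > 0\<close> \<open>0 < \<delta>\<close> \<open>\<delta> < 1\<close> c L F]
    let ?P = "gram_cols n F + (lam * sigma_k) \<cdot>\<^sub>m ones_mat n + L"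
    let ?A = "K + (lam * sigma_k) \<cdot>\<^sub>m ones_mat n + L"
    have "A_norm ?A (pcg ?A ?P b t - mat_inv ?A *\<^sub>v b) \<le> \<epsilon> * A_norm ?A (mat_inv ?A *\<^sub>v b)"
      if b: "b \<in> carrier_vec n" and t: "real t \<ge> \<delta> powr (-1/2) * ln (2 / \<epsilon>)" for b t
      by (rule quality(2)[OF b \<open>0 < \<epsilon>\<close> \<open>\<epsilon> < 1\<close> t])
    then show "F \<in> ?good" using quality(1) by (simp add: Let_def)
  qed
  then have "measure_pmf.prob (rpc n K r) ?T \<le> measure_pmf.prob (rpc n K r) ?good"
    by (intro measure_pmf.finite_measure_mono) auto
  then show ?thesis
    using RPCholesky_trace_prob[OF K \<open>\<mu> > 0\<close> \<open>0 < \<delta>\<close> RPCholesky_trace_bound[OF K \<open>\<mu> > 0\<close> r_bound]]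
    unfolding rpc by linarith
qed

end
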